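(* Consider MSLR-D (defined in the context) with $(\beta_1,\beta_2)\sim\mathcal{P}_{\|\beta\|_2}(\mathcal{D})$, outside the symmetric balanced regime (i.e. it is not the case that both $\phi=1/2$ and $\beta_1=-\beta_2$). Let $\epsilon\in(0,1)$ be the parameter used in CORR. Then, provided $$n\;\ge\;\frac{32(1+\epsilon)}{\min\{\phi^2\beta_{\min}^2,\;(1-\phi)^2\beta_{\min}^2,\;\langle\beta\rangle^2_{>0}\}}\cdot\frac{\|\beta\|_2^2(\mathrm{SNR}+1)}{\mathrm{SNR}}\,\log(2p),$$ the CORR algorithm solves strong detection in MSLR-D.
   Context: **Scaling regime.** $p\to\infty$, $n\to\infty$, $k=o(p)$, $n=\omega(k)$. **Signal prior.** For $\mathcal{D}\subseteq\mathbb{R}$, $\mathcal{P}_{\|\beta\|_2}(\mathcal{D})$ denotes a joint distribution of a pair $(\beta_1,\beta_2)$ such that each of $\beta_1,\beta_2$ is marginally uniform over $k$-sparse vectors of $\mathbb{R}^p$ (exactly $k$ nonzero entries) whose nonzero entries lie in $\mathcal{D}$, and such that $\beta_1,\beta_2$ have the same fixed Euclidean norm, denoted $\|\beta\|_2$. It is assumed that $\beta_{\min}:=\min\{|b|:b\in\mathcal{D}\}>0$. $\mathrm{SNR}:=\|\beta\|_2^2/\sigma^2$. **Detection problem MSLR-D.** Let $\sigma>0$, $\phi\in(0,1)$. $X\in\mathbb{R}^{n\times p}$ has i.i.d. $\mathcal{N}(0,1)$ entries, $w\in\mathbb{R}^n$ has i.i.d. $\mathcal{N}(0,1)$ entries,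 $z\in\{0,1\}^n$ has i.i.d. Bernoulli$(\phi)$ entries, $(\beta_1,\beta_2)\sim\mathcal{P}_{\|\beta\|_2}(\mathcal{D})$, all independent. One observes $(X,y)$ and must distinguish the null $\mathbb{P}(X)\otimes\mathbb{P}(y)$: $y=\sqrt{\|\beta\|_2^2/\sigma^2+1}\;w$, from the alternative $\mathbb{P}(X,y)$: $y=\frac1\sigma X\beta_1\odot z+\frac1\sigma X\beta_2\odot(1-z)+w$ ($\odot$ is the entrywise product). **Strong detection:** the test succeeds with probability $1-o(1)$ as $p\to\infty$ under both hypotheses. **Notation.** $\mathcal{S}_1,\mathcal{S}_2$ are the supports of $\beta_1,\beta_2$, and $$\langle\beta\rangle^2_{>0}:=\min\{(\phi\beta_{1,j}+(1-\phi)\beta_{2,j})^2:\ j\in\mathcal{S}_1\cup\mathcal{S}_2,\ \phi\beta_{1,j}+(1-\phi)\beta_{2,j}\neq0\}.$$ **CORR.** With $X_j$ the $j$-th column of $X$ and $\tau=\sqrt{2(1+\epsilon/2)\log(2p)}$, CORR outputs the set $\{j\in[p]:\ |\langle X_j,y\rangle|/\|y\|_2\ge\tau\}$. As a test, CORR declares the alternative $\mathbb{P}(X,y)$ if this set is nonempty and the null otherwise. *)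

theory Defs
  imports "HOL-Probability.Probability" "HOL-Library.Landau_Symbols"
begin

text \<open>
  Since the dimensions \<open>p\<close> and \<open>n\<close> vary, a vector of \<open>\<real>\<^sup>d\<close> is a function
  \<open>nat \<Rightarrow> real\<close> in \<open>extensional {..<d}\<close>, and an \<open>n \<times> p\<close> matrix is a function on pairs in
  \<open>extensional ({..<n} \<times> {..<p})\<close>.
\<close>

abbreviation vec_borel :: "'i set \<Rightarrow> ('i \<Rightarrow> real) measure" where
  "vec_borel I \<equiv> Pi\<^sub>M I (\<lambda>_. borel)"

definition gaussian :: "'i set \<Rightarrow> ('i \<Rightarrow> real) measure" where
  "gaussian I = Pi\<^sub>M I (\<lambda>_. density lborel (normal_density 0 1))"


subsection \<open>Uniform distributions on subsets of Euclidean space\<close>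

text \<open>
  The set of admissible signals is finite when the alphabet \<open>D\<close> is, and then ``uniform'' means
  equal point masses. In order not to restrict \<open>D\<close>, the uniform distribution on \<open>S\<close> is the
  normalised Hausdorff measure of the dimension in which \<open>S\<close> has positive finite measure
  (dimension 0 is counting measure; for smooth pieces of a sphere this is surface measure).
  The usual multiplicative constant in the Hausdorff measure cancels.
\<close>

definition l2_diam :: "nat \<Rightarrow> (nat \<Rightarrow> real) set \<Rightarrow> ennreal" where
  "l2_diam p U = (SUP x\<in>U. SUP y\<in>U. ennreal (L2_set (\<lambda>j. x j - y j) {..<p}))"

text \<open>In dimension 0 a nonempty set has weight \<open>0 ^ 0 = 1\<close> even if it is a single point.\<close>

definition hausdorff :: "nat \<Rightarrow> nat \<Rightarrow> (nat \<Rightarrow> real) set \<Rightarrow> ennreal" where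
  "hausdorff p d A =
     (SUP \<delta>\<in>{0::real<..}. INF U\<in>{U :: nat \<Rightarrow> (nat \<Rightarrow> real) set.
          A \<subseteq> (\<Union>i. U i) \<and> (\<forall>i. l2_diam p (U i) \<le> ennreal \<delta>)}.
        (\<Sum>i. if U i = {} then 0 else l2_diam p (U i) ^ d))"

text \<open>The almost-everywhere clause follows from the last one if \<open>S\<close> is a Borel set.\<close>

definition uniform_on :: "nat \<Rightarrow> (nat \<Rightarrow> real) set \<Rightarrow> (nat \<Rightarrow> real) measure \<Rightarrow> bool" where
  "uniform_on p S M \<longleftrightarrow>
     prob_space M \<and> sets M = sets (vec_borel {..<p}) \<and> (AE x in M. x \<in> S) \<and>
     (\<exists>d. 0 < hausdorff p d S \<and> hausdorff p d S < \<infinity> \<and>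
          (\<forall>A\<in>sets M. emeasure M A = hausdorff p d (A \<inter> S) / hausdorff p d S))"

lemma l2_diam_singleton: "l2_diam p {x} = 0"
  by (simp add: l2_diam_def L2_set_def)

lemma l2_diam_empty: "l2_diam p {} = 0"
  by (simp add: l2_diam_def bot_ennreal)

lemma l2_diam_ge: "x \<in> U \<Longrightarrow> y \<in> U \<Longrightarrow> ennreal (L2_set (\<lambda>j. x j - y j) {..<p}) \<le> l2_diam p U"
  unfolding l2_diam_def by (meson SUP_upper2 order_refl)

lemma hausdorff_finite_le:
  assumes "finite S"
  shows "hausdorff p d S \<le> (if d = 0 then of_nat (card S) else 0)"
proof -
  obtain e where e: "bij_betw e {..<card S} S"
    using assms ex_bij_betw_nat_finite[of S] by (auto simp: atLeast0LessThan)
  define U where "U = (\<lambda>i. if i < card S then {e i} else {})"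
  have cov: "S \<subseteq> (\<Union>i. U i)"
    using e by (force simp: U_def bij_betw_def)
  have s: "(\<Sum>i. if U i = {} then 0 else l2_diam p (U i) ^ d)
        = (\<Sum>i<card S. if U i = {} then 0 else l2_diam p (U i) ^ d)"
    by (rule suminf_finite) (auto simp: U_def)
  also have "\<dots> = (if d = 0 then of_nat (card S) else (0::ennreal))"
    by (auto simp: U_def l2_diam_singleton)
  finally have s: "(\<Sum>i. if U i = {} then 0 else l2_diam p (U i) ^ d) = (if d = 0 then of_nat (card S) else (0::ennreal))" .
  show ?thesis unfolding hausdorff_def
    apply (rule SUP_least)
    apply (subst s[symmetric])
    apply (rule INF_lower)
    using cov by (auto simp: U_def l2_diam_singleton l2_diam_empty)
qed

lemma hausdorff_zero_finite:
  assumes "finite S" "S \<subseteq> extensional {..<p}"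
  shows "hausdorff p 0 S = of_nat (card S)"
proof (rule antisym)
  show "hausdorff p 0 S \<le> of_nat (card S)" using hausdorff_finite_le[OF assms(1), of p 0] by simp
  let ?d = "\<lambda>x y::nat\<Rightarrow>real. L2_set (\<lambda>j. x j - y j) {..<p}"
  have pos: "?d x y > 0" if xy: "x \<in> S" "y \<in> S" "x \<noteq> y" for x y
  proof -
    have "x \<in> extensional {..<p}" "y \<in> extensional {..<p}"
      using xy assms(2) by auto
    then obtain j where j: "j \<in> {..<p}" "x j \<noteq> y j"
      using extensionalityI[of x "{..<p}" y] xy(3) by blast
    then have "?d x y \<noteq> 0"
      using L2_set_eq_0_iff[of "{..<p}" "\<lambda>j. x j - y j"] by auto
    then show ?thesis
      using L2_set_nonneg[of "\<lambda>j. x j - y j" "{..<p}"] by linarith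
  qed
  define T where "T = insert 1 ((\<lambda>(x,y). ?d x y) ` {(x,y). x\<in>S \<and> y\<in>S \<and> x \<noteq> y})"
  have "finite {(x,y). x\<in>S \<and> y\<in>S \<and> x \<noteq> y}"
    by (rule finite_subset[of _ "S \<times> S"]) (auto simp: assms(1))
  then have "finite T" unfolding T_def by simp
  define \<delta> where "\<delta> = Min T / 2"
  have Tp: "Min T > 0" using \<open>finite T\<close> pos by (subst Min_gr_iff) (auto simp: T_def)
  have lt: "\<delta> < ?d x y" if "x \<in> S" "y \<in> S" "x \<noteq> y" for x y
  proof -
    have "Min T \<le> ?d x y" using \<open>finite T\<close> that by (intro Min_le) (auto simp: T_def)
    then show ?thesis using Tp by (simp add: \<delta>_def)
  qed
  have "of_nat (card S) \<le> (\<Sum>i. if U i = {} then 0 else l2_diam p (U i) ^ 0)"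
    if U: "S \<subseteq> (\<Union>i. U i)" "\<forall>i. l2_diam p (U i) \<le> ennreal \<delta>" for U
  proof -
    obtain f where f: "\<And>x. x \<in> S \<Longrightarrow> x \<in> U (f x)" using U(1) by (metis UN_E subsetD)
    have "inj_on f S"
    proof (rule inj_onI, rule ccontr)
      fix x y assume xy: "x \<in> S" "y \<in> S" "f x = f y" "x \<noteq> y"
      then have "ennreal (?d x y) \<le> ennreal \<delta>"
        using l2_diam_ge[of x "U (f x)" y p] f U(2) by (metis order_trans)
      then show False using lt[OF xy(1,2,4)] Tp by (simp add: \<delta>_def)
    qed
    then have "of_nat (card S) = (\<Sum>i\<in>f`S. (1::ennreal))" by (simp add: card_image)
    also have "\<dots> = (\<Sum>i\<in>f`S. if U i = {} then 0 else l2_diam p (U i) ^ 0)"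
      using f by (intro sum.cong) auto
    also have "\<dots> \<le> (\<Sum>i. if U i = {} then 0 else l2_diam p (U i) ^ 0)"
      using assms(1) by (intro sum_le_suminf) auto
    finally show ?thesis .
  qed
  then show "of_nat (card S) \<le> hausdorff p 0 S" unfolding hausdorff_def
    using Tp by (intro SUP_upper2[of \<delta>] INF_greatest) (auto simp: \<delta>_def)
qed

text \<open>On a finite set this is the uniform distribution in the usual sense.\<close>

lemma uniform_on_finite_iff:
  assumes "finite S" "S \<noteq> {}" "S \<subseteq> extensional {..<p}" "prob_space M"
    and sM: "sets M = sets (vec_borel {..<p})"
  shows "uniform_on p S M \<longleftrightarrow> (\<forall>x\<in>S. emeasure M {x} = 1 / of_nat (card S))"
proof -
  interpret prob_space M by fact
  have c: "card S > 0" using assms by (simp add: card_gt_0_iff)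
  have sg: "{x} \<in> sets M" if "x \<in> S" for x
  proof -
    have "{x} = (\<Pi>\<^sub>E j\<in>{..<p}. {x j})" using that assms(3)
      using PiE_singleton by blast
    then show ?thesis unfolding sM by (simp add: sets_PiM_I_finite)
  qed
  have Sm: "A \<in> sets M" if "A \<subseteq> S" for A
  proof -
    have "finite A" using that assms(1) finite_subset by blast
    then have "(\<Union>x\<in>A. {x}) \<in> sets M" using that sg by (intro sets.finite_UN) auto
    then show ?thesis by simp
  qed
  have dz: "d = 0" if "0 < hausdorff p d S" for d
    using hausdorff_finite_le[OF assms(1), of p d] that by (auto split: if_splits)
  have h: "hausdorff p 0 A = of_nat (card A)" if "A \<subseteq> S" for A
    using that assms by (intro hausdorff_zero_finite) (auto intro: finite_subset)
  show ?thesis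
  proof
    assume "uniform_on p S M"
    then obtain d where d: "0 < hausdorff p d S" "\<forall>A\<in>sets M. emeasure M A = hausdorff p d (A \<inter> S) / hausdorff p d S"
      unfolding uniform_on_def by blast
    then have "d = 0" using dz by blast
    show "\<forall>x\<in>S. emeasure M {x} = 1 / of_nat (card S)"
      using d(2) sg h unfolding \<open>d=0\<close> by auto
  next
    assume a: "\<forall>x\<in>S. emeasure M {x} = 1 / of_nat (card S)"
    have em: "emeasure M A = of_nat (card A) / of_nat (card S)" if "A \<subseteq> S" for A
    proof -
      have "finite A" using that assms(1) finite_subset by blast
      then have "emeasure M A = (\<Sum>x\<in>A. emeasure M {x})"
        using that sg by (intro emeasure_eq_sum_singleton) auto
      also have "\<dots> = (\<Sum>x\<in>A. 1 / of_nat (card S))" using a that by (intro sum.cong) auto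
      finally show ?thesis by (simp add: ennreal_times_divide)
    qed
    have "emeasure M S = 1" using em[of S] c by (simp add: ennreal_divide_self of_nat_less_top)
    then have AE: "AE x in M. x \<in> S" using Sm[of S]
      by (simp add: emeasure_eq_measure AE_in_set_eq_1)
    have "emeasure M A = hausdorff p 0 (A \<inter> S) / hausdorff p 0 S" if A: "A \<in> sets M" for A
    proof -
      have "emeasure M A = emeasure M (A \<inter> S)"
        using AE A Sm[of "A \<inter> S"] by (intro emeasure_eq_AE) auto
      then show ?thesis using em[of "A \<inter> S"] h[of "A \<inter> S"] h[of S] by simp
    qed
    moreover have "0 < hausdorff p 0 S" "hausdorff p 0 S < \<infinity>"
      using h[of S] c by (simp_all add: of_nat_less_top)
    ultimately show "uniform_on p S M"
      unfolding uniform_on_def by (intro conjI exI[of _ 0] ballI AE sM assms(4))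
  qed
qed


subsection \<open>Signals\<close>

definition supp :: "nat \<Rightarrow> (nat \<Rightarrow> real) \<Rightarrow> nat set" where
  "supp p b = {j. j < p \<and> b j \<noteq> 0}"

definition sparse_signals :: "nat \<Rightarrow> nat \<Rightarrow> real set \<Rightarrow> real \<Rightarrow> (nat \<Rightarrow> real) set" where
  "sparse_signals p k D r =
     {b \<in> extensional {..<p}. card (supp p b) = k \<and> (\<forall>j\<in>supp p b. b j \<in> D) \<and>
        L2_set b {..<p} = r}"

text \<open>
  \<open>signal_prior p k D r \<mu>\<close>: \<open>\<mu>\<close> is a law of a pair of signals with common norm \<open>r\<close>; the coupling
  of the two uniform marginals is arbitrary. If the law that is uniform over all \<open>k\<close>-sparse
  vectors with nonzero entries in \<open>D\<close> has constant norm \<open>r\<close>, then it is also the uniform law over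
  those of norm \<open>r\<close>, so fixing the norm in \<open>sparse_signals\<close> loses nothing.
\<close>

definition signal_prior ::
  "nat \<Rightarrow> nat \<Rightarrow> real set \<Rightarrow> real \<Rightarrow> ((nat \<Rightarrow> real) \<times> (nat \<Rightarrow> real)) measure \<Rightarrow> bool" where
  "signal_prior p k D r \<mu> \<longleftrightarrow>
     prob_space \<mu> \<and> sets \<mu> = sets (vec_borel {..<p} \<Otimes>\<^sub>M vec_borel {..<p}) \<and>
     uniform_on p (sparse_signals p k D r) (distr \<mu> (vec_borel {..<p}) fst) \<and>
     uniform_on p (sparse_signals p k D r) (distr \<mu> (vec_borel {..<p}) snd)"

text \<open>The infimum is the minimum whenever the minimum exists.\<close>

definition beta_min :: "real set \<Rightarrow> real" where
  "beta_min D = Inf (abs ` D)"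

definition SNR :: "real \<Rightarrow> real \<Rightarrow> real" where
  "SNR r \<sigma> = r\<^sup>2 / \<sigma>\<^sup>2"

text \<open>
  The set below is finite, and it is nonempty for signals of equal nonzero norm outside the
  symmetric balanced regime.
\<close>

definition mean_sq_min :: "nat \<Rightarrow> real \<Rightarrow> (nat \<Rightarrow> real) \<Rightarrow> (nat \<Rightarrow> real) \<Rightarrow> real" where
  "mean_sq_min p \<phi> b1 b2 =
     Min {(\<phi> * b1 j + (1 - \<phi>) * b2 j)\<^sup>2 |j.
            j \<in> supp p b1 \<union> supp p b2 \<and> \<phi> * b1 j + (1 - \<phi>) * b2 j \<noteq> 0}"

definition symmetric_balanced :: "nat \<Rightarrow> real \<Rightarrow> (nat \<Rightarrow> real) \<Rightarrow> (nat \<Rightarrow> real) \<Rightarrow> bool" where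
  "symmetric_balanced p \<phi> b1 b2 \<longleftrightarrow> \<phi> = 1/2 \<and> (\<forall>j<p. b1 j = - b2 j)"


subsection \<open>The detection problem\<close>

type_synonym observation = "(nat \<times> nat \<Rightarrow> real) \<times> (nat \<Rightarrow> real)"

definition null_law :: "nat \<Rightarrow> nat \<Rightarrow> real \<Rightarrow> real \<Rightarrow> observation measure" where
  "null_law n p r \<sigma> =
     gaussian ({..<n} \<times> {..<p}) \<Otimes>\<^sub>M
     distr (gaussian {..<n}) (vec_borel {..<n})
       (\<lambda>w. \<lambda>i\<in>{..<n}. sqrt (r\<^sup>2 / \<sigma>\<^sup>2 + 1) * w i)"

definition mslr_response ::
  "nat \<Rightarrow> nat \<Rightarrow> real \<Rightarrow> (nat \<times> nat \<Rightarrow> real) \<Rightarrow> (nat \<Rightarrow> real) \<Rightarrow> (nat \<Rightarrow> bool) \<Rightarrow>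
     (nat \<Rightarrow> real) \<Rightarrow> (nat \<Rightarrow> real) \<Rightarrow> (nat \<Rightarrow> real)" where
  "mslr_response n p \<sigma> X w z b1 b2 =
     (\<lambda>i\<in>{..<n}. 1 / \<sigma> * (\<Sum>j<p. X (i, j) * b1 j) * of_bool (z i)
               + 1 / \<sigma> * (\<Sum>j<p. X (i, j) * b2 j) * (1 - of_bool (z i)) + w i)"

definition alt_law ::
  "nat \<Rightarrow> nat \<Rightarrow> real \<Rightarrow> real \<Rightarrow> ((nat \<Rightarrow> real) \<times> (nat \<Rightarrow> real)) measure \<Rightarrow> observation measure" where
  "alt_law n p \<sigma> \<phi> \<mu> =
     distr
       (gaussian ({..<n} \<times> {..<p}) \<Otimes>\<^sub>M gaussian {..<n} \<Otimes>\<^sub>M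
          Pi\<^sub>M {..<n} (\<lambda>_. measure_pmf (bernoulli_pmf \<phi>)) \<Otimes>\<^sub>M \<mu>)
       (vec_borel ({..<n} \<times> {..<p}) \<Otimes>\<^sub>M vec_borel {..<n})
       (\<lambda>(X, w, z, b1, b2). (X, mslr_response n p \<sigma> X w z b1 b2))"

text \<open>
  A test returns \<open>True\<close> to declare the alternative. The laws and tests are indexed by the
  position in a sequence of problem instances.
\<close>

definition strong_detection ::
  "(nat \<Rightarrow> 'a measure) \<Rightarrow> (nat \<Rightarrow> 'a measure) \<Rightarrow> (nat \<Rightarrow> 'a \<Rightarrow> bool) \<Rightarrow> bool" where
  "strong_detection Q P T \<longleftrightarrow>
     (\<lambda>m. measure (Q m) {x \<in> space (Q m). \<not> T m x}) \<longlonglongrightarrow> 1 \<and>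
     (\<lambda>m. measure (P m) {x \<in> space (P m). T m x}) \<longlonglongrightarrow> 1"


subsection \<open>The algorithm\<close>

definition corr_threshold :: "nat \<Rightarrow> real \<Rightarrow> real" where
  "corr_threshold p \<epsilon> = sqrt (2 * (1 + \<epsilon> / 2) * ln (2 * real p))"

definition corr :: "nat \<Rightarrow> nat \<Rightarrow> real \<Rightarrow> observation \<Rightarrow> nat set" where
  "corr n p \<epsilon> = (\<lambda>(X, y).
     {j. j < p \<and> \<bar>\<Sum>i<n. X (i, j) * y i\<bar> / L2_set y {..<n} \<ge> corr_threshold p \<epsilon>})"

definition corr_test :: "nat \<Rightarrow> nat \<Rightarrow> real \<Rightarrow> observation \<Rightarrow> bool" where
  "corr_test n p \<epsilon> obs \<longleftrightarrow> corr n p \<epsilon> obs \<noteq> {}"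

end

theory Submission
  imports Defs
begin

text \<open>
  Under the null, \<open>\<langle>X\<^sub>j, y\<rangle> / \<parallel>y\<parallel>\<close> is standard normal for every fixed \<open>y \<noteq> 0\<close>, so a union bound over the
  \<open>p\<close> columns gives false positive probability at most \<open>2 p exp (- \<tau>\<^sup>2 / 2) = (2 p) powr (- \<epsilon> / 2)\<close>.

  Under the alternative, fix the signals and a column \<open>j\<close> attaining the minimum defining
  \<open>mean_sq_min\<close>; write \<open>m = \<phi> \<beta>\<^sub>1\<^sub>j + (1 - \<phi>) \<beta>\<^sub>2\<^sub>j \<noteq> 0\<close> and \<open>v = SNR + 1\<close>. Because both signals have
  the same norm, each \<open>y\<^sub>i\<close> is \<open>N(0, v)\<close> whatever the label, and the summands \<open>X\<^sub>i\<^sub>j y\<^sub>i\<close> of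
  \<open>\<langle>X\<^sub>j, y\<rangle>\<close> have mean \<open>m / \<sigma>\<close> and second moment at most \<open>3 v\<close>. Chebyshev's inequality then gives
  \<open>\<bar>\<langle>X\<^sub>j, y\<rangle>\<bar> \<ge> n \<bar>m\<bar> / (2 \<sigma>)\<close> and \<open>\<parallel>y\<parallel>\<^sup>2 \<le> 4 n v\<close> outside an event of probability
  \<open>O(1 / log (2 p) + 1 / n)\<close>, and the constant 32 in the sample size is what makes the quotient exceed \<open>\<tau>\<close>.
  No concentration inequality beyond second moments is needed.
\<close>

section \<open>Independence in product spaces and second moments of independent sums\<close>

text \<open>Restricting to the index set is the identity on the product space, so the joint law of
  the coordinates is already the product of their marginals.\<close>

lemma indep_vars_PiM_components:
  assumes "I \<noteq> {}" and M: "\<And>i. i \<in> I \<Longrightarrow> prob_space (M i)"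
  shows "prob_space.indep_vars (Pi\<^sub>M I M) M (\<lambda>i x. x i) I"
proof -
  interpret prob_space "Pi\<^sub>M I M" using M by (intro prob_space_PiM) auto
  have "distr (Pi\<^sub>M I M) (Pi\<^sub>M I M) (\<lambda>x. \<lambda>i\<in>I. x i) = distr (Pi\<^sub>M I M) (Pi\<^sub>M I M) (\<lambda>x. x)"
    by (intro distr_cong) (auto simp: space_PiM)
  also have "\<dots> = Pi\<^sub>M I M" by (rule distr_id)
  also have "\<dots> = (\<Pi>\<^sub>M i\<in>I. distr (Pi\<^sub>M I M) (M i) (\<lambda>x. x i))"
    using M by (intro PiM_cong) (auto simp: distr_PiM_component)
  finally show ?thesis
    using assms by (subst indep_vars_iff_distr_eq_PiM') auto
qed

text \<open>\<open>V'\<close> says that \<open>V j\<close>, although defined on the whole product,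
  reads only the block \<open>K j\<close>, and disjoint blocks are independent. The intended blocks
  are the rows of the design matrix.\<close>

lemma indep_vars_PiM_blocks:
  assumes "I \<noteq> {}" and M: "\<And>i. i \<in> I \<Longrightarrow> prob_space (M i)"
    and K: "\<And>j. j \<in> L \<Longrightarrow> K j \<subseteq> I" "disjoint_family_on K L"
    and V: "\<And>j. j \<in> L \<Longrightarrow> V j \<in> measurable (Pi\<^sub>M (K j) M) (N j)"
    and V': "\<And>j x. j \<in> L \<Longrightarrow> V j (restrict x (K j)) = V j x"
  shows "prob_space.indep_vars (Pi\<^sub>M I M) N V L"
proof -
  interpret prob_space "Pi\<^sub>M I M" using M by (intro prob_space_PiM) auto
  have "indep_vars (\<lambda>j. Pi\<^sub>M (K j) M) (\<lambda>j x. restrict (\<lambda>i. x i) (K j)) L"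
    using assms by (intro indep_vars_restrict[OF indep_vars_PiM_components]) auto
  then have "indep_vars N (\<lambda>j x. V j (restrict x (K j))) L"
    by (intro indep_vars_compose2[where Y=V]) (use V in auto)
  then show ?thesis
    by (rule indep_vars_cong[THEN iffD1, rotated -1]) (auto simp: V')
qed

text \<open>Bias-variance decomposition: after centring, independence kills the cross terms, and
  each variance is at most \<open>B\<close>. The target \<open>a\<close> is left free because the
  labels are later held fixed while the target is a mean over the labels; the bias then carries the
  label fluctuation.\<close>

lemma (in prob_space) second_moment_indep_sum:
  fixes V :: "'i \<Rightarrow> 'a \<Rightarrow> real"
  assumes "finite I" and ind: "indep_vars (\<lambda>_. borel) V I"
    and sq: "\<And>i. i \<in> I \<Longrightarrow> integrable M (\<lambda>x. (V i x)\<^sup>2)"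
    and B: "\<And>i. i \<in> I \<Longrightarrow> expectation (\<lambda>x. (V i x)\<^sup>2) \<le> B"
  shows "integrable M (\<lambda>x. ((\<Sum>i\<in>I. V i x) - a)\<^sup>2)"
    and "expectation (\<lambda>x. ((\<Sum>i\<in>I. V i x) - a)\<^sup>2)
           \<le> real (card I) * B + ((\<Sum>i\<in>I. expectation (V i)) - a)\<^sup>2"
proof -
  have rv [measurable]: "V i \<in> borel_measurable M" if "i \<in> I" for i
    using ind that by (auto simp: indep_vars_def)
  have int: "integrable M (V i)" if "i \<in> I" for i
    using square_integrable_imp_integrable rv sq that by blast
  have prod: "integrable M (\<lambda>x. V i x * V j x) \<and>
      expectation (\<lambda>x. V i x * V j x) = expectation (V i) * expectation (V j)"
    if "i \<in> I" "j \<in> I" "i \<noteq> j" for i j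
  proof -
    have "indep_vars (\<lambda>_. borel) V {i, j}"
      using ind by (rule indep_vars_subset) (use that in auto)
    then show ?thesis
      using indep_vars_integrable[of "{i, j}" V] indep_vars_lebesgue_integral[of "{i, j}" V] int that
      by auto
  qed
  \<comment> \<open>The centred summands, followed by the bias of the sum against the
    target.\<close>
  define W where [abs_def]: "W i x = V i x - expectation (V i)" for i x
  define c where "c = (\<Sum>i\<in>I. expectation (V i)) - a"
  have W: "integrable M (W i)" "expectation (W i) = 0" if "i \<in> I" for i
    using int[OF that] by (simp_all add: W_def prob_space)
  have WW: "integrable M (\<lambda>x. W i x * W j x)" if "i \<in> I" "j \<in> I" for i j
    using sq prod int that by (cases "i = j")
      (auto simp: W_def algebra_simps power2_eq_square)
  have W0: "expectation (\<lambda>x. W i x * W j x) = 0" if "i \<in> I" "j \<in> I" "i \<noteq> j" for i j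
    using prod[OF that] int that by (simp add: W_def algebra_simps prob_space)
  have W2: "expectation (\<lambda>x. W i x * W i x) \<le> B" if "i \<in> I" for i
  proof -
    have "expectation (\<lambda>x. W i x * W i x) = variance (V i)"
      by (simp add: W_def power2_eq_square)
    also have "\<dots> \<le> B"
      using variance_eq[OF int[OF that] sq[OF that]] B[OF that] zero_le_power2[of "expectation (V i)"]
      by linarith
    finally show ?thesis .
  qed
  have eq: "((\<Sum>i\<in>I. V i x) - a)\<^sup>2 =
      (\<Sum>i\<in>I. \<Sum>j\<in>I. W i x * W j x) + 2 * c * (\<Sum>i\<in>I. W i x) + c\<^sup>2" for x
  proof -
    have "(\<Sum>i\<in>I. V i x) - a = (\<Sum>i\<in>I. W i x) + c"
      by (simp add: W_def c_def sum_subtractf)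
    then show ?thesis
      by (simp add: power2_sum sum_product[symmetric] power2_eq_square algebra_simps)
  qed
  show "integrable M (\<lambda>x. ((\<Sum>i\<in>I. V i x) - a)\<^sup>2)"
    unfolding eq using W WW by auto
  have "expectation (\<lambda>x. ((\<Sum>i\<in>I. V i x) - a)\<^sup>2) =
      (\<Sum>i\<in>I. \<Sum>j\<in>I. expectation (\<lambda>x. W i x * W j x)) + c\<^sup>2"
    unfolding eq using W WW by (simp add: Bochner_Integration.integral_sum prob_space)
  also have "(\<Sum>i\<in>I. \<Sum>j\<in>I. expectation (\<lambda>x. W i x * W j x)) =
      (\<Sum>i\<in>I. expectation (\<lambda>x. W i x * W i x))"
  proof (intro sum.cong refl)
    fix i assume i: "i \<in> I"
    have "(\<Sum>j\<in>I. expectation (\<lambda>x. W i x * W j x)) = (\<Sum>j\<in>{i}. expectation (\<lambda>x. W i x * W j x))"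
      using \<open>finite I\<close> i W0[OF i] by (intro sum.mono_neutral_right) auto
    then show "(\<Sum>j\<in>I. expectation (\<lambda>x. W i x * W j x)) = expectation (\<lambda>x. W i x * W i x)"
      by simp
  qed
  also have "\<dots> \<le> real (card I) * B"
    using W2 by (rule sum_bounded_above)
  finally show "expectation (\<lambda>x. ((\<Sum>i\<in>I. V i x) - a)\<^sup>2)
           \<le> real (card I) * B + ((\<Sum>i\<in>I. expectation (V i)) - a)\<^sup>2"
    by (simp add: c_def)
qed

subsection \<open>Gaussian vectors\<close>

lemma prob_space_gaussian: "prob_space (gaussian I)"
  unfolding gaussian_def by (intro prob_space_PiM prob_space_normal_density) simp

lemma sets_gaussian [measurable_cong]: "sets (gaussian I) = sets (vec_borel I)"
  unfolding gaussian_def by (intro sets_PiM_cong) auto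

lemma measurable_gaussian_restrict:
  "A \<subseteq> K \<Longrightarrow> (\<lambda>x. restrict x A) \<in> gaussian K \<rightarrow>\<^sub>M vec_borel A"
  by (auto simp: measurable_cong_sets[OF sets_gaussian refl]
      intro!: measurable_restrict measurable_component_singleton)

lemma distr_gaussian_reindex:
  assumes "inj_on f I" "f ` I \<subseteq> K"
  shows "distr (gaussian K) (vec_borel I) (\<lambda>x. \<lambda>i\<in>I. x (f i)) = gaussian I"
proof -
  have "distr (gaussian K) (gaussian I) (\<lambda>x. \<lambda>i\<in>I. x (f i)) = gaussian I"
    unfolding gaussian_def using assms
    by (intro distr_PiM_reindex prob_space_normal_density) auto
  then show ?thesis
    by (metis distr_cong sets_gaussian)
qed

text \<open>Disjoint coordinate blocks of one Gaussian vector are independent. Design and noise can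
  thus be read off a single vector, in which each response entry is one linear form.\<close>

lemma gaussian_pair:
  assumes "inj_on f I" "inj_on g J" "f ` I \<subseteq> K" "g ` J \<subseteq> K" "f ` I \<inter> g ` J = {}" "K \<noteq> {}"
  shows "gaussian I \<Otimes>\<^sub>M gaussian J =
    distr (gaussian K) (vec_borel I \<Otimes>\<^sub>M vec_borel J) (\<lambda>x. (\<lambda>i\<in>I. x (f i), \<lambda>j\<in>J. x (g j)))"
proof -
  interpret prob_space "gaussian K" by (rule prob_space_gaussian)
  let ?b = "density lborel (normal_density 0 1)"
  have "indep_vars (\<lambda>_. ?b) (\<lambda>i x. x i) K"
    unfolding gaussian_def by (intro indep_vars_PiM_components prob_space_normal_density) (use assms in auto)
  then have "indep_var (Pi\<^sub>M (f ` I) (\<lambda>_. ?b)) (\<lambda>x. restrict x (f ` I))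
      (Pi\<^sub>M (g ` J) (\<lambda>_. ?b)) (\<lambda>x. restrict x (g ` J))"
    using indep_var_restrict[of "\<lambda>_. ?b" "\<lambda>i x. x i" K "f ` I" "g ` J"] assms by auto
  \<comment> \<open>Composing with \<open>id\<close> only replaces the target spaces by Borel
    products, which have the same measurable sets.\<close>
  then have "indep_var (vec_borel (f ` I)) (id \<circ> (\<lambda>x. restrict x (f ` I)))
      (vec_borel (g ` J)) (id \<circ> (\<lambda>x. restrict x (g ` J)))"
    by (rule indep_var_compose) (auto intro!: measurable_ident_sets sets_PiM_cong)
  then have 1: "gaussian (f ` I) \<Otimes>\<^sub>M gaussian (g ` J) =
      distr (gaussian K) (vec_borel (f ` I) \<Otimes>\<^sub>M vec_borel (g ` J))
        (\<lambda>x. (restrict x (f ` I), restrict x (g ` J)))"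
    using assms distr_gaussian_reindex[of id "f ` I" K] distr_gaussian_reindex[of id "g ` J" K]
    by (simp add: indep_var_distribution_eq comp_def)
  have m [measurable]: "(\<lambda>x. \<lambda>i\<in>I. x (f i)) \<in> vec_borel (f ` I) \<rightarrow>\<^sub>M vec_borel I"
    "(\<lambda>x. \<lambda>j\<in>J. x (g j)) \<in> vec_borel (g ` J) \<rightarrow>\<^sub>M vec_borel J"
    by (auto intro!: measurable_restrict measurable_component_singleton)
  have "gaussian I \<Otimes>\<^sub>M gaussian J =
      distr (gaussian (f ` I)) (vec_borel I) (\<lambda>x. \<lambda>i\<in>I. x (f i)) \<Otimes>\<^sub>M
      distr (gaussian (g ` J)) (vec_borel J) (\<lambda>x. \<lambda>j\<in>J. x (g j))"
    using assms by (simp add: distr_gaussian_reindex)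
  also have "\<dots> = distr (gaussian (f ` I) \<Otimes>\<^sub>M gaussian (g ` J)) (vec_borel I \<Otimes>\<^sub>M vec_borel J)
      (\<lambda>(x, y). (\<lambda>i\<in>I. x (f i), \<lambda>j\<in>J. y (g j)))"
    using assms by (intro pair_measure_distr)
      (auto simp: distr_gaussian_reindex prob_space_gaussian prob_space_imp_sigma_finite)
  also have "\<dots> = distr (gaussian K) (vec_borel I \<Otimes>\<^sub>M vec_borel J)
      ((\<lambda>(x, y). (\<lambda>i\<in>I. x (f i), \<lambda>j\<in>J. y (g j))) \<circ> (\<lambda>x. (restrict x (f ` I), restrict x (g ` J))))"
    unfolding 1 using assms
    by (intro distr_distr measurable_Pair measurable_gaussian_restrict) auto
  also have "(\<lambda>(x, y). (\<lambda>i\<in>I. x (f i), \<lambda>j\<in>J. y (g j))) \<circ> (\<lambda>x. (restrict x (f ` I), restrict x (g ` J)))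
      = (\<lambda>x. (\<lambda>i\<in>I. x (f i), \<lambda>j\<in>J. x (g j)))"
    by (auto simp: fun_eq_iff)
  finally show ?thesis .
qed

text \<open>A sum of independent normals is normal and the variances add. The variance must be
  positive for the law to have a density.\<close>

lemma gaussian_linear:
  assumes "finite S" "S \<subseteq> K" and pos: "0 < (\<Sum>i\<in>S. (c i)\<^sup>2)"
  shows "distributed (gaussian K) lborel (\<lambda>x. \<Sum>i\<in>S. c i * x i)
    (normal_density 0 (sqrt (\<Sum>i\<in>S. (c i)\<^sup>2)))"
proof -
  interpret prob_space "gaussian K" by (rule prob_space_gaussian)
  let ?b = "density lborel (normal_density 0 1)"
  \<comment> \<open>The summation rule for normals wants every summand nondegenerate. Dropping zero
    coefficients changes neither the form nor its variance.\<close>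
  define S' where "S' = {i \<in> S. c i \<noteq> 0}"
  have S': "finite S'" "S' \<subseteq> K" using assms by (auto simp: S'_def)
  have ne: "S' \<noteq> {}"
  proof
    assume "S' = {}"
    then have "(\<Sum>i\<in>S. (c i)\<^sup>2) = 0" by (intro sum.neutral) (auto simp: S'_def)
    with pos show False by simp
  qed
  have "indep_vars (\<lambda>_. ?b) (\<lambda>i x. x i) K"
    unfolding gaussian_def by (intro indep_vars_PiM_components prob_space_normal_density) (use ne S' in auto)
  then have "indep_vars (\<lambda>_. ?b) (\<lambda>i x. x i) S'"
    by (rule indep_vars_subset) (use S' in auto)
  then have ind: "indep_vars (\<lambda>_. borel) (\<lambda>i x. c i * x i) S'"
    by (rule indep_vars_compose2[where Y="\<lambda>i x. c i * x"]) auto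
  have "distributed (gaussian K) lborel (\<lambda>x. c i * x i) (normal_density 0 \<bar>c i\<bar>)" if i: "i \<in> S'" for i
  proof -
    have "i \<in> K" "c i \<noteq> 0" using i S' by (auto simp: S'_def)
    have "distr (gaussian K) ?b (\<lambda>x. x i) = ?b"
      unfolding gaussian_def by (intro distr_PiM_component prob_space_normal_density) (use \<open>i \<in> K\<close> in auto)
    then have "distr (gaussian K) lborel (\<lambda>x. x i) = ?b"
      by (metis distr_cong sets_density)
    then have "distributed (gaussian K) lborel (\<lambda>x. x i) (normal_density 0 1)"
      using \<open>i \<in> K\<close> by (auto simp: distributed_def)
    from normal_density_affine[OF this _ \<open>c i \<noteq> 0\<close>, of 0] show ?thesis by simp
  qed
  then have "distributed (gaussian K) lborel (\<lambda>x. \<Sum>i\<in>S'. c i * x i)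
      (normal_density (\<Sum>i\<in>S'. 0) (sqrt (\<Sum>i\<in>S'. \<bar>c i\<bar>\<^sup>2)))"
    using S' ne ind by (intro sum_indep_normal) (auto simp: S'_def)
  moreover have "(\<Sum>i\<in>S'. c i * x i) = (\<Sum>i\<in>S. c i * x i)" for x
    using assms by (intro sum.mono_neutral_left) (auto simp: S'_def)
  moreover have "(\<Sum>i\<in>S'. \<bar>c i\<bar>\<^sup>2) = (\<Sum>i\<in>S. (c i)\<^sup>2)"
    using assms by (simp, intro sum.mono_neutral_left) (auto simp: S'_def)
  ultimately show ?thesis by simp
qed

text \<open>These are the even moments of a centred normal with variance \<open>v\<close>. For
  \<open>v = 0\<close> there is no density, but then the form vanishes identically.\<close>

lemma gaussian_linear_moments:
  fixes c :: "'i \<Rightarrow> real"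
  assumes "finite S" "S \<subseteq> K"
  defines "v \<equiv> \<Sum>i\<in>S. (c i)\<^sup>2" and "L \<equiv> \<lambda>x. \<Sum>i\<in>S. c i * x i"
  shows "integrable (gaussian K) (\<lambda>x. (L x)\<^sup>2)" "(\<integral>x. (L x)\<^sup>2 \<partial>gaussian K) = v"
    "integrable (gaussian K) (\<lambda>x. (L x) ^ 4)" "(\<integral>x. (L x) ^ 4 \<partial>gaussian K) = 3 * v\<^sup>2"
proof -
  interpret prob_space "gaussian K" by (rule prob_space_gaussian)
  have "integrable (gaussian K) (\<lambda>x. (L x)\<^sup>2) \<and> (\<integral>x. (L x)\<^sup>2 \<partial>gaussian K) = v \<and>
    integrable (gaussian K) (\<lambda>x. (L x) ^ 4) \<and> (\<integral>x. (L x) ^ 4 \<partial>gaussian K) = 3 * v\<^sup>2"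
  proof (cases "v = 0")
    case True
    then have "c i = 0" if "i \<in> S" for i
      using assms that by (auto simp: sum_nonneg_eq_0_iff)
    then have "L x = 0" for x by (simp add: L_def)
    then show ?thesis by (simp add: True)
  next
    case False
    then have pos: "0 < v" unfolding v_def by (simp add: sum_nonneg order.not_eq_order_implies_strict)
    then have s: "0 < sqrt v" by simp
    have D: "distributed (gaussian K) lborel L (normal_density 0 (sqrt v))"
      using gaussian_linear[OF assms(1,2)] pos unfolding v_def L_def by simp
    have m: "integrable lborel (\<lambda>x. normal_density 0 (sqrt v) x * x ^ k)" for k
      using integrable_normal_moment[OF s, of 0 k] by simp
    have i: "integrable (gaussian K) (\<lambda>x. L x ^ k)" for k
      using m[of k] distributed_integrable[OF D, of "\<lambda>x. x ^ k"] by simp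
    have "(\<integral>x. L x ^ 2 \<partial>gaussian K) = v" "(\<integral>x. L x ^ 4 \<partial>gaussian K) = 3 * v\<^sup>2"
      using integral_normal_moment_even[OF s, of 0 1] integral_normal_moment_even[OF s, of 0 2]
        distributed_integral[OF D, of "\<lambda>x. x ^ 2"] distributed_integral[OF D, of "\<lambda>x. x ^ 4"] pos
      by (simp_all add: fact_numeral power_divide)
    then show ?thesis using i by blast
  qed
  then show "integrable (gaussian K) (\<lambda>x. (L x)\<^sup>2)" "(\<integral>x. (L x)\<^sup>2 \<partial>gaussian K) = v"
    "integrable (gaussian K) (\<lambda>x. (L x) ^ 4)" "(\<integral>x. (L x) ^ 4 \<partial>gaussian K) = 3 * v\<^sup>2"
    by auto
qed

text \<open>The mean is the covariance of \<open>x j\<close> and \<open>L\<close>. By Isserlis'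
  formula the second moment equals \<open>v + 2 * (c j)^2\<close>, which is at most
  \<open>3 * v\<close>; the proof reaches the same bound through fourth moments alone.\<close>

lemma gaussian_coord_times_linear:
  fixes c :: "'i \<Rightarrow> real"
  assumes "finite S" "S \<subseteq> K" "j \<in> S"
  defines "v \<equiv> \<Sum>i\<in>S. (c i)\<^sup>2" and "L \<equiv> \<lambda>x. \<Sum>i\<in>S. c i * x i"
  assumes v: "1 \<le> v"
  shows "integrable (gaussian K) (\<lambda>x. (x j * L x)\<^sup>2)" "(\<integral>x. (x j * L x)\<^sup>2 \<partial>gaussian K) \<le> 3 * v"
    "(\<integral>x. x j * L x \<partial>gaussian K) = c j"
proof -
  interpret prob_space "gaussian K" by (rule prob_space_gaussian)
  have "j \<in> K" using assms by auto
  have Lm: "integrable (gaussian K) (\<lambda>x. (L x)\<^sup>2)" "(\<integral>x. (L x)\<^sup>2 \<partial>gaussian K) = v"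
    "integrable (gaussian K) (\<lambda>x. (L x) ^ 4)" "(\<integral>x. (L x) ^ 4 \<partial>gaussian K) = 3 * v\<^sup>2"
    using gaussian_linear_moments[OF assms(1,2), of c] unfolding v_def L_def by simp_all
  note Xm = gaussian_linear_moments[of "{j}" K "\<lambda>_. 1", simplified, OF \<open>j \<in> K\<close>]
  have [measurable]: "L \<in> borel_measurable (gaussian K)"
    unfolding L_def using assms by (intro borel_measurable_sum borel_measurable_times) (auto simp: gaussian_def)
  have [measurable]: "(\<lambda>x. x j) \<in> borel_measurable (gaussian K)"
    using \<open>j \<in> K\<close> by (auto simp: gaussian_def)
  \<comment> \<open>AM-GM, weighted so that both fourth moments contribute equally\<close>
  have le: "(x j * L x)\<^sup>2 \<le> v / 2 * x j ^ 4 + 1 / (2 * v) * L x ^ 4" for x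
  proof -
    have "0 \<le> (v * (x j)\<^sup>2 - (L x)\<^sup>2)\<^sup>2 / (2 * v)" using v by simp
    also have "\<dots> = v / 2 * x j ^ 4 + 1 / (2 * v) * L x ^ 4 - (x j * L x)\<^sup>2"
      using v by (simp add: field_simps power2_eq_square power4_eq_xxxx)
    finally show ?thesis by simp
  qed
  have I: "integrable (gaussian K) (\<lambda>x. v / 2 * x j ^ 4 + 1 / (2 * v) * L x ^ 4)"
    using Lm Xm by auto
  show "integrable (gaussian K) (\<lambda>x. (x j * L x)\<^sup>2)"
  proof (rule Bochner_Integration.integrable_bound[OF I])
    show "AE x in gaussian K. norm ((x j * L x)\<^sup>2) \<le> norm (v / 2 * x j ^ 4 + 1 / (2 * v) * L x ^ 4)"
      using order_trans[OF le abs_ge_self] by (intro AE_I2) (simp only: real_norm_def abs_power2)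
  qed simp
  then have "(\<integral>x. (x j * L x)\<^sup>2 \<partial>gaussian K) \<le>
      (\<integral>x. v / 2 * x j ^ 4 + 1 / (2 * v) * L x ^ 4 \<partial>gaussian K)"
    using I le by (intro integral_mono) auto
  also have "\<dots> = 3 * v"
    using Lm Xm v by (simp add: field_simps power2_eq_square)
  finally show "(\<integral>x. (x j * L x)\<^sup>2 \<partial>gaussian K) \<le> 3 * v" .
  \<comment> \<open>polarization\<close>
  let ?c = "\<lambda>i. c i + of_bool (i = j)"
  have e: "(\<Sum>i\<in>S. ?c i * x i) = L x + x j" for x
  proof -
    have "(\<Sum>i\<in>S. ?c i * x i) = (\<Sum>i\<in>S. c i * x i + (if i = j then x j else 0))"
      by (intro sum.cong) (auto simp: algebra_simps)
    then show ?thesis using assms by (simp add: L_def sum.distrib)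
  qed
  have "(\<Sum>i\<in>S. (?c i)\<^sup>2) = (\<Sum>i\<in>S. (c i)\<^sup>2 + (if i = j then 2 * c j + 1 else 0))"
    by (intro sum.cong) (auto simp: power2_eq_square algebra_simps)
  also have "\<dots> = v + 2 * c j + 1"
    using assms by (simp add: sum.distrib v_def)
  finally have f: "(\<Sum>i\<in>S. (?c i)\<^sup>2) = v + 2 * c j + 1" .
  note Sm = gaussian_linear_moments[OF assms(1,2), of ?c, unfolded e f]
  have "(\<integral>x. x j * L x \<partial>gaussian K) = (\<integral>x. ((L x + x j)\<^sup>2 - (L x)\<^sup>2 - (x j)\<^sup>2) / 2 \<partial>gaussian K)"
    by (intro Bochner_Integration.integral_cong) (auto simp: power2_eq_square algebra_simps)
  also have "\<dots> = c j"
    using Sm Lm Xm by simp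
  finally show "(\<integral>x. x j * L x \<partial>gaussian K) = c j" .
qed

subsection \<open>False positives under the null\<close>

text \<open>If \<open>s\<close> is \<open>t\<close> or \<open>- t\<close> with the sign of
  \<open>x\<close>, then \<open>s * x \<ge> t^2\<close> gives
  \<open>x^2 \<ge> t^2 + (x - s)^2\<close>. On the tail the density is therefore at most
  \<open>exp (- t^2 / 2)\<close> times a normal density centred at \<open>s\<close>; integrating
  both shifted densities produces the factor 2.\<close>

lemma standard_normal_tail:
  assumes D: "distributed M lborel Z (normal_density 0 1)" and "0 \<le> t"
  shows "emeasure M {x \<in> space M. t \<le> \<bar>Z x\<bar>} \<le> ennreal (2 * exp (- t\<^sup>2 / 2))"
proof -
  have le: "normal_density 0 1 x * indicator {x. t \<le> \<bar>x\<bar>} x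
      \<le> exp (- t\<^sup>2 / 2) * (normal_density t 1 x + normal_density (- t) 1 x)" for x
  proof -
    have *: "normal_density 0 1 x \<le> exp (- t\<^sup>2 / 2) * normal_density s 1 x" if "s\<^sup>2 = t\<^sup>2" "t\<^sup>2 \<le> s * x" for s
    proof -
      have "exp (- x\<^sup>2 / 2) \<le> exp (- t\<^sup>2 / 2 + - (x - s)\<^sup>2 / 2)"
      proof -
        have "(x - s)\<^sup>2 = x\<^sup>2 + t\<^sup>2 - 2 * (s * x)"
          using that(1) by (simp add: power2_diff)
        then have "- x\<^sup>2 / 2 \<le> - t\<^sup>2 / 2 + - (x - s)\<^sup>2 / 2"
          using that(2) by linarith
        then show ?thesis by (simp only: exp_le_cancel_iff)
      qed
      then have "exp (- x\<^sup>2 / 2) / sqrt (2 * pi) \<le> exp (- t\<^sup>2 / 2) * exp (- (x - s)\<^sup>2 / 2) / sqrt (2 * pi)"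
        unfolding exp_add by (intro divide_right_mono) auto
      then show ?thesis by (simp add: normal_density_def)
    qed
    show ?thesis
    proof (cases "t \<le> \<bar>x\<bar>")
      case True
      define s where "s = (if 0 \<le> x then t else - t)"
      have s: "s = t \<or> s = - t" "t\<^sup>2 \<le> s * x"
        using mult_left_mono[OF True \<open>0 \<le> t\<close>] by (auto simp: s_def power2_eq_square)
      then have "normal_density 0 1 x \<le> exp (- t\<^sup>2 / 2) * normal_density s 1 x"
        by (intro *) auto
      \<comment> \<open>Adding the density with the opposite centre makes the bound independent of
        the sign of \<open>x\<close>.\<close>
      also have "\<dots> \<le> exp (- t\<^sup>2 / 2) * (normal_density t 1 x + normal_density (- t) 1 x)"
        using s(1) by (intro mult_left_mono) auto
      finally show ?thesis using True by simp
    qed simp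
  qed
  have "emeasure M {x \<in> space M. t \<le> \<bar>Z x\<bar>} = emeasure M (Z -` {x. t \<le> \<bar>x\<bar>} \<inter> space M)"
    by (rule arg_cong[where f="emeasure M"]) auto
  also have "\<dots> = (\<integral>\<^sup>+x. ennreal (normal_density 0 1 x) * indicator {x. t \<le> \<bar>x\<bar>} x \<partial>lborel)"
    by (rule distributed_emeasure[OF D]) simp
  also have "\<dots> = (\<integral>\<^sup>+x. ennreal (normal_density 0 1 x * indicator {x. t \<le> \<bar>x\<bar>} x) \<partial>lborel)"
    by (intro nn_integral_cong) (auto simp: indicator_def)
  also have "\<dots> \<le> (\<integral>\<^sup>+x. ennreal (exp (- t\<^sup>2 / 2) * (normal_density t 1 x + normal_density (- t) 1 x)) \<partial>lborel)"
    using le by (intro nn_integral_mono ennreal_leI)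
  also have "\<dots> = ennreal (\<integral>x. exp (- t\<^sup>2 / 2) * (normal_density t 1 x + normal_density (- t) 1 x) \<partial>lborel)"
    by (intro nn_integral_eq_integral) auto
  also have "\<dots> = ennreal (2 * exp (- t\<^sup>2 / 2))"
    by simp
  finally show ?thesis .
qed

lemma corr_test_iff:
  "corr_test n p \<epsilon> (X, y) \<longleftrightarrow>
    (\<exists>j\<in>{..<p}. corr_threshold p \<epsilon> \<le> \<bar>\<Sum>i<n. X (i, j) * y i\<bar> / L2_set y {..<n})"
  by (auto simp: corr_test_def corr_def)

lemma measurable_corr_test [measurable]:
  "Measurable.pred (vec_borel ({..<n} \<times> {..<p}) \<Otimes>\<^sub>M vec_borel {..<n}) (corr_test n p \<epsilon>)"
proof -
  have "Measurable.pred (vec_borel ({..<n} \<times> {..<p}) \<Otimes>\<^sub>M vec_borel {..<n})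
    (\<lambda>obs. \<exists>j\<in>{..<p}. corr_threshold p \<epsilon> \<le>
      \<bar>\<Sum>i<n. fst obs (i, j) * snd obs i\<bar> / sqrt (\<Sum>i<n. (snd obs i)\<^sup>2))"
    by measurable
  then show ?thesis
    by (rule measurable_cong[THEN iffD1, rotated]) (auto simp: corr_test_iff L2_set_def)
qed

text \<open>For fixed nonzero \<open>y\<close>, each normalised correlation is a linear form in the
  design with unit coefficient vector, hence standard normal. A union bound over the columns
  follows.\<close>

lemma corr_test_fixed_response:
  assumes "0 < corr_threshold p \<epsilon>"
  shows "emeasure (gaussian ({..<n} \<times> {..<p})) {X \<in> space (gaussian ({..<n} \<times> {..<p})). corr_test n p \<epsilon> (X, y)}
    \<le> ennreal (2 * real p * exp (- (corr_threshold p \<epsilon>)\<^sup>2 / 2))"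
proof -
  let ?K = "{..<n} \<times> {..<p}" and ?t = "corr_threshold p \<epsilon>"
  let ?A = "\<lambda>j. {X \<in> space (gaussian ?K). ?t \<le> \<bar>\<Sum>i<n. X (i, j) * y i\<bar> / L2_set y {..<n}}"
  have meas: "?A j \<in> sets (gaussian ?K)" if "j < p" for j
  proof -
    have "(\<lambda>X. X (i, j)) \<in> borel_measurable (gaussian ?K)" if "i < n" for i
      using that \<open>j < p\<close> by (simp add: gaussian_def)
    then have "(\<lambda>X. \<bar>\<Sum>i<n. X (i, j) * y i\<bar> / L2_set y {..<n}) \<in> borel_measurable (gaussian ?K)"
      by (auto intro!: borel_measurable_sum borel_measurable_times borel_measurable_divide borel_measurable_abs)
    then show ?thesis by measurable
  qed
  have bound: "emeasure (gaussian ?K) (?A j) \<le> ennreal (2 * exp (- ?t\<^sup>2 / 2))" if "j < p" for j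
  proof (cases "L2_set y {..<n} = 0")
    \<comment> \<open>Division by zero yields 0, which lies below the positive threshold, so no
      column is selected.\<close>
    case True
    then have "?A j = {}" using assms by auto
    then show ?thesis by (simp only: emeasure_empty zero_le)
  next
    case False
    let ?l = "L2_set y {..<n}"
    have l: "?l > 0" using False L2_set_nonneg[of y "{..<n}"] by linarith
    define S where "S = (\<lambda>i. (i, j)) ` {..<n}"
    define c where "c q = y (fst q) / ?l" for q :: "nat \<times> nat"
    have inj: "inj_on (\<lambda>i. (i, j)) {..<n}" by (auto simp: inj_on_def)
    have "(\<Sum>q\<in>S. (c q)\<^sup>2) = (\<Sum>i<n. (y i)\<^sup>2) / ?l\<^sup>2"
      by (simp add: S_def sum.reindex[OF inj] c_def power_divide sum_divide_distrib)
    also have "\<dots> = 1"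
      using l by (simp add: L2_set_def sum_nonneg)
    finally have c: "(\<Sum>q\<in>S. (c q)\<^sup>2) = 1" .
    have "distributed (gaussian ?K) lborel (\<lambda>X. \<Sum>q\<in>S. c q * X q) (normal_density 0 1)"
      using gaussian_linear[of S ?K c] c \<open>j < p\<close> by (auto simp: S_def)
    then have "emeasure (gaussian ?K) {X \<in> space (gaussian ?K). ?t \<le> \<bar>\<Sum>q\<in>S. c q * X q\<bar>}
        \<le> ennreal (2 * exp (- ?t\<^sup>2 / 2))"
      by (rule standard_normal_tail) (use assms in simp)
    also have "(\<lambda>X. \<bar>\<Sum>q\<in>S. c q * X q\<bar>) = (\<lambda>X. \<bar>\<Sum>i<n. X (i, j) * y i\<bar> / ?l)"
      using l by (simp add: S_def sum.reindex[OF inj] c_def sum_divide_distrib[symmetric] mult.commute abs_divide)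
    finally show ?thesis .
  qed
  have "{X \<in> space (gaussian ?K). corr_test n p \<epsilon> (X, y)} = (\<Union>j\<in>{..<p}. ?A j)"
    by (auto simp: corr_test_iff)
  also have "emeasure (gaussian ?K) \<dots> \<le> (\<Sum>j<p. emeasure (gaussian ?K) (?A j))"
    using meas by (intro emeasure_subadditive_finite) auto
  also have "\<dots> \<le> (\<Sum>j<p. ennreal (2 * exp (- ?t\<^sup>2 / 2)))"
    using bound by (intro sum_mono) auto
  also have "\<dots> = ennreal (2 * real p * exp (- ?t\<^sup>2 / 2))"
    by (simp add: ennreal_mult' ennreal_of_nat_eq_real_of_nat[symmetric] mult_ac)
  finally show ?thesis .
qed

lemma sets_null_law: "sets (null_law n p r \<sigma>) = sets (vec_borel ({..<n} \<times> {..<p}) \<Otimes>\<^sub>M vec_borel {..<n})"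
  unfolding null_law_def by (intro sets_pair_measure_cong) (auto simp: sets_gaussian)

text \<open>Design and response are independent under the null, and the bound for a fixed response
  is uniform in \<open>y\<close>; integrating it over the law of \<open>y\<close> leaves it
  unchanged.\<close>

lemma
  shows prob_space_null_law: "prob_space (null_law n p r \<sigma>)"
    and null_false_positive: "0 < corr_threshold p \<epsilon> \<Longrightarrow>
      emeasure (null_law n p r \<sigma>) {x \<in> space (null_law n p r \<sigma>). corr_test n p \<epsilon> x}
        \<le> ennreal (2 * real p * exp (- (corr_threshold p \<epsilon>)\<^sup>2 / 2))"
proof -
  let ?A = "gaussian ({..<n} \<times> {..<p})"
  let ?B = "distr (gaussian {..<n}) (vec_borel {..<n}) (\<lambda>w. \<lambda>i\<in>{..<n}. sqrt (r\<^sup>2 / \<sigma>\<^sup>2 + 1) * w i)"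
  interpret A: prob_space ?A by (rule prob_space_gaussian)
  interpret B: prob_space ?B
    by (intro prob_space.prob_space_distr prob_space_gaussian)
       (auto simp: measurable_cong_sets[OF sets_gaussian refl] intro!: measurable_restrict)
  interpret AB: pair_prob_space ?A ?B ..
  show "prob_space (null_law n p r \<sigma>)"
    unfolding null_law_def by (rule AB.prob_space_axioms)
  assume t: "0 < corr_threshold p \<epsilon>"
  let ?E = "{x \<in> space (null_law n p r \<sigma>). corr_test n p \<epsilon> x}"
  have "?E \<in> sets (null_law n p r \<sigma>)"
    using measurable_corr_test[of n p \<epsilon>]
    by (intro predE) (simp add: measurable_cong_sets[OF sets_null_law refl])
  then have "emeasure (null_law n p r \<sigma>) ?E = (\<integral>\<^sup>+y. emeasure ?A ((\<lambda>x. (x, y)) -` ?E) \<partial>?B)"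
    unfolding null_law_def by (rule AB.emeasure_pair_measure_alt2)
  also have "\<dots> = (\<integral>\<^sup>+y. emeasure ?A {X \<in> space ?A. corr_test n p \<epsilon> (X, y)} \<partial>?B)"
    by (intro nn_integral_cong arg_cong[where f="emeasure ?A"])
       (auto simp: null_law_def space_pair_measure)
  also have "\<dots> \<le> (\<integral>\<^sup>+y. ennreal (2 * real p * exp (- (corr_threshold p \<epsilon>)\<^sup>2 / 2)) \<partial>?B)"
    using t by (intro nn_integral_mono corr_test_fixed_response)
  also have "\<dots> = ennreal (2 * real p * exp (- (corr_threshold p \<epsilon>)\<^sup>2 / 2))"
    using B.emeasure_space_1 by simp
  finally show "emeasure (null_law n p r \<sigma>) ?E \<le> ennreal (2 * real p * exp (- (corr_threshold p \<epsilon>)\<^sup>2 / 2))" .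
qed

subsection \<open>Misses under the alternative\<close>

text \<open>Distinct rows use disjoint coordinates, so the row contributions are independent. The
  constants \<open>3 * v\<close> and \<open>3 * v^2\<close> bound the second moments of
  \<open>x (i, j) * L i x\<close> and of \<open>(L i x)^2\<close>.\<close>

lemma gaussian_rows_second_moments:
  fixes c :: "nat \<times> nat \<Rightarrow> real" and n q j :: nat and a v :: real
  defines "K \<equiv> {..<n} \<times> {..<q}"
    and "L \<equiv> \<lambda>i x. \<Sum>l<q. c (i, l) * x (i, l)"
  assumes j: "j < q" and n: "0 < n" and "1 \<le> v"
    and v: "\<And>i. i < n \<Longrightarrow> (\<Sum>l<q. (c (i, l))\<^sup>2) = v"
  shows "integrable (gaussian K) (\<lambda>x. ((\<Sum>i<n. x (i, j) * L i x) - a)\<^sup>2)"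
    and "(\<integral>x. ((\<Sum>i<n. x (i, j) * L i x) - a)\<^sup>2 \<partial>gaussian K)
      \<le> real n * (3 * v) + ((\<Sum>i<n. c (i, j)) - a)\<^sup>2"
    and "integrable (gaussian K) (\<lambda>x. ((\<Sum>i<n. (L i x)\<^sup>2) - real n * v)\<^sup>2)"
    and "(\<integral>x. ((\<Sum>i<n. (L i x)\<^sup>2) - real n * v)\<^sup>2 \<partial>gaussian K) \<le> real n * (3 * v\<^sup>2)"
proof -
  interpret prob_space "gaussian K" by (rule prob_space_gaussian)
  let ?b = "density lborel (normal_density 0 1)"
  let ?S = "\<lambda>i. (\<lambda>l. (i, l)) ` {..<q}"
  have inj: "inj_on (\<lambda>l. (i, l)) {..<q}" for i :: nat by (auto simp: inj_on_def)
  have L: "L i = (\<lambda>x. \<Sum>s\<in>?S i. c s * x s)" for i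
    by (simp add: L_def sum.reindex[OF inj] fun_eq_iff)
  have vS: "(\<Sum>s\<in>?S i. (c s)\<^sup>2) = v" if "i < n" for i
    using v[OF that] by (simp add: sum.reindex[OF inj])
  have S: "finite (?S i)" "?S i \<subseteq> K" "(i, j) \<in> ?S i" if "i < n" for i
    using that j by (auto simp: K_def)
  have Lm: "L i \<in> borel_measurable (Pi\<^sub>M (?S i) (\<lambda>_. ?b))" for i
    unfolding L by (intro borel_measurable_sum borel_measurable_times) auto
  have xm: "(\<lambda>x. x (i, j)) \<in> borel_measurable (Pi\<^sub>M (?S i) (\<lambda>_. ?b))" for i
  proof -
    have "(\<lambda>x. x (i, j)) \<in> Pi\<^sub>M (?S i) (\<lambda>_. ?b) \<rightarrow>\<^sub>M ?b"
      using j by (intro measurable_component_singleton) auto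
    then show ?thesis by simp
  qed
  have Lr: "L i (restrict x (?S i)) = L i x" for i x
    unfolding L by (intro sum.cong) auto
  \<comment> \<open>Stated for a general \<open>V\<close>, since it serves both the correlation
    terms and the squared responses.\<close>
  have ind: "indep_vars (\<lambda>_. borel) V {..<n}"
    if "\<And>i. i < n \<Longrightarrow> V i \<in> borel_measurable (Pi\<^sub>M (?S i) (\<lambda>_. ?b))"
      and "\<And>i x. i < n \<Longrightarrow> V i (restrict x (?S i)) = V i x" for V
    unfolding gaussian_def
    by (rule indep_vars_PiM_blocks[where K="?S"])
       (use that S j n prob_space_normal_density[of 1 0] in \<open>auto simp: K_def disjoint_family_on_def\<close>)
  have indT: "indep_vars (\<lambda>_. borel) (\<lambda>i x. x (i, j) * L i x) {..<n}"
  proof (rule ind)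
    show "(\<lambda>x. x (i, j) * L i x) \<in> borel_measurable (Pi\<^sub>M (?S i) (\<lambda>_. ?b))" for i
      using xm Lm by (rule borel_measurable_times)
    show "restrict x (?S i) (i, j) * L i (restrict x (?S i)) = x (i, j) * L i x" for i x
      using j by (simp add: Lr)
  qed
  have indQ: "indep_vars (\<lambda>_. borel) (\<lambda>i x. (L i x)\<^sup>2) {..<n}"
    by (rule ind) (auto simp: Lr intro: borel_measurable_power Lm)
  have Tm: "integrable (gaussian K) (\<lambda>x. (x (i, j) * L i x)\<^sup>2)"
    "expectation (\<lambda>x. (x (i, j) * L i x)\<^sup>2) \<le> 3 * v"
    "expectation (\<lambda>x. x (i, j) * L i x) = c (i, j)" if "i \<in> {..<n}" for i
    using gaussian_coord_times_linear[OF S, of i c] that vS[of i] \<open>1 \<le> v\<close> by (auto simp: L)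
  have Qm: "integrable (gaussian K) (\<lambda>x. ((L i x)\<^sup>2)\<^sup>2)"
    "expectation (\<lambda>x. ((L i x)\<^sup>2)\<^sup>2) \<le> 3 * v\<^sup>2"
    "expectation (\<lambda>x. (L i x)\<^sup>2) = v" if "i \<in> {..<n}" for i
    using gaussian_linear_moments[OF S(1,2), of i c] that vS[of i] by (auto simp: L)
  show "integrable (gaussian K) (\<lambda>x. ((\<Sum>i<n. x (i, j) * L i x) - a)\<^sup>2)"
    by (rule second_moment_indep_sum[OF _ indT Tm(1,2)]) auto
  show "(\<integral>x. ((\<Sum>i<n. x (i, j) * L i x) - a)\<^sup>2 \<partial>gaussian K)
      \<le> real n * (3 * v) + ((\<Sum>i<n. c (i, j)) - a)\<^sup>2"
    using second_moment_indep_sum(2)[OF _ indT Tm(1,2), of a] by (simp add: Tm(3))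
  show "integrable (gaussian K) (\<lambda>x. ((\<Sum>i<n. (L i x)\<^sup>2) - real n * v)\<^sup>2)"
    by (rule second_moment_indep_sum[OF _ indQ Qm(1,2)]) auto
  \<comment> \<open>The target \<open>n * v\<close> is the exact mean, so the bias term is
    zero.\<close>
  show "(\<integral>x. ((\<Sum>i<n. (L i x)\<^sup>2) - real n * v)\<^sup>2 \<partial>gaussian K) \<le> real n * (3 * v\<^sup>2)"
    using second_moment_indep_sum(2)[OF _ indQ Qm(1,2), of "real n * v"] by (simp add: Qm(3))
qed

text \<open>Chebyshev's inequality is applied twice: to the correlation, at distance half of
  \<open>n * a\<close>, and to the squared norm of the response, at distance
  \<open>3 * n * v\<close>. Here \<open>a\<close> stands for the label-averaged mean of a summand;
  since the coefficients are frozen, the numerator keeps the deviation of their sum from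
  \<open>n * a\<close>.\<close>

lemma corr_miss_fixed_coefficients:
  fixes c :: "nat \<times> nat \<Rightarrow> real" and n p j :: nat and a v \<epsilon> :: real
  defines "Y \<equiv> \<lambda>X w. \<lambda>i\<in>{..<n}. (\<Sum>l<p. X (i, l) * c (i, l)) + w i"
    and "G \<equiv> gaussian ({..<n} \<times> {..<p}) \<Otimes>\<^sub>M gaussian {..<n}"
    and "t \<equiv> corr_threshold p \<epsilon>"
  assumes j: "j < p" and n: "0 < n" and a: "a \<noteq> 0" and t: "0 \<le> t"
    and v: "\<And>i. i < n \<Longrightarrow> (\<Sum>l<p. (c (i, l))\<^sup>2) + 1 = v"
    and le: "16 * v * t\<^sup>2 \<le> real n * a\<^sup>2"
  shows "emeasure G {(X, w) \<in> space G. \<not> corr_test n p \<epsilon> (X, Y X w)} \<le>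
    ennreal ((real n * (3 * v) + ((\<Sum>i<n. c (i, j)) - real n * a)\<^sup>2) / (real n * a / 2)\<^sup>2 + 1 / (3 * real n))"
proof -
  define K where "K = {..<n} \<times> {..<Suc p}"
  \<comment> \<open>The noise becomes an extra column \<open>p\<close> with coefficient 1, so each
    response entry is a linear form \<open>L i\<close> of variance \<open>v\<close>.\<close>
  define d where "d = (\<lambda>(i, l). if l < p then c (i, l) else 1)"
  define L where "L = (\<lambda>i (x :: nat \<times> nat \<Rightarrow> real). \<Sum>l<Suc p. d (i, l) * x (i, l))"
  define T where "T = (\<lambda>x. \<Sum>i<n. x (i, j) * L i x)"
  define N where "N = (\<lambda>x. \<Sum>i<n. (L i x)\<^sup>2)"
  interpret prob_space "gaussian K" by (rule prob_space_gaussian)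
  have v1: "1 \<le> v" using v[OF n] sum_nonneg[of "{..<p}" "\<lambda>l. (c (0, l))\<^sup>2"] by simp
  have vd: "(\<Sum>l<Suc p. (d (i, l))\<^sup>2) = v" if "i < n" for i
    using v[OF that] by (simp add: d_def)
  have jp: "j < Suc p" and dj: "d (i, j) = c (i, j)" for i
    using j by (simp_all add: d_def)
  have M: "integrable (gaussian K) (\<lambda>x. (T x - real n * a)\<^sup>2)"
    "(\<integral>x. (T x - real n * a)\<^sup>2 \<partial>gaussian K) \<le> real n * (3 * v) + ((\<Sum>i<n. c (i, j)) - real n * a)\<^sup>2"
    "integrable (gaussian K) (\<lambda>x. (N x - real n * v)\<^sup>2)"
    "(\<integral>x. (N x - real n * v)\<^sup>2 \<partial>gaussian K) \<le> real n * (3 * v\<^sup>2)"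
    using gaussian_rows_second_moments(1,2)[where a="real n * a", OF jp n v1 vd]
      gaussian_rows_second_moments(3,4)[OF jp n v1 vd]
    unfolding T_def N_def L_def K_def dj by blast+
  \<comment> \<open>Splits the enlarged matrix back into design and noise.\<close>
  define h where "h = (\<lambda>x :: nat \<times> nat \<Rightarrow> real. (\<lambda>s\<in>{..<n} \<times> {..<p}. x s, \<lambda>i\<in>{..<n}. x (i, p)))"
  let ?V = "vec_borel ({..<n} \<times> {..<p}) \<Otimes>\<^sub>M vec_borel {..<n}"
  have G: "G = distr (gaussian K) ?V h"
    unfolding G_def h_def
    by (rule gaussian_pair[where f="\<lambda>s. s" and g="\<lambda>i. (i, p)"])
       (use n in \<open>auto simp: K_def inj_on_def lessThan_empty_iff\<close>)
  have h: "h \<in> gaussian K \<rightarrow>\<^sub>M ?V"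
    unfolding h_def
    by (auto simp: measurable_cong_sets[OF sets_gaussian refl] K_def
        intro!: measurable_Pair measurable_restrict)
  have Y: "(\<lambda>(X, w). Y X w) \<in> ?V \<rightarrow>\<^sub>M vec_borel {..<n}"
    unfolding Y_def split_def by (rule measurable_restrict) measurable
  have "Measurable.pred ?V (\<lambda>z. corr_test n p \<epsilon> (fst z, (\<lambda>(X, w). Y X w) z))"
    by (rule measurable_compose[OF _ measurable_corr_test, where f="\<lambda>z. (fst z, (\<lambda>(X, w). Y X w) z)"])
       (intro measurable_Pair measurable_fst Y)
  then have "Measurable.pred ?V (\<lambda>z. \<not> corr_test n p \<epsilon> (fst z, (\<lambda>(X, w). Y X w) z))"
    by measurable
  then have meas: "{z \<in> space ?V. \<not> corr_test n p \<epsilon> (fst z, (\<lambda>(X, w). Y X w) z)} \<in> sets ?V"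
    by (rule predE)
  have Yh: "(\<lambda>(X, w). Y X w) (h x) = (\<lambda>i\<in>{..<n}. L i x)" for x
    by (auto simp: Y_def h_def L_def d_def fun_eq_iff mult.commute)
  have hit: "corr_test n p \<epsilon> (fst (h x), \<lambda>i\<in>{..<n}. L i x)"
    if 1: "\<bar>T x - real n * a\<bar> < \<bar>real n * a / 2\<bar>" and 2: "N x - real n * v < 3 * real n * v" for x
  proof -
    let ?y = "\<lambda>i\<in>{..<n}. L i x"
    have T: "(\<Sum>i<n. fst (h x) (i, j) * ?y i) = T x"
      using j by (simp add: T_def h_def)
    have N: "(L2_set ?y {..<n})\<^sup>2 = N x"
      by (simp add: L2_set_def N_def sum_nonneg)
    have Tx: "\<bar>real n * a / 2\<bar> < \<bar>T x\<bar>" using 1 by linarith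
    \<comment> \<open>The goal is \<open>4 * n * v * t^2 \<le> (n * a / 2)^2\<close>, which is the
      hypothesis \<open>le\<close> multiplied by \<open>n / 4\<close>.\<close>
    have "t\<^sup>2 * N x \<le> t\<^sup>2 * (4 * real n * v)"
      using 2 by (intro mult_left_mono) (simp_all add: mult_ac)
    also have "\<dots> = (real n * (16 * v * t\<^sup>2)) / 4" by simp
    also have "\<dots> \<le> (real n * (real n * a\<^sup>2)) / 4"
      using le by (intro divide_right_mono mult_left_mono) auto
    also have "\<dots> = (real n * a / 2)\<^sup>2" by (simp add: power2_eq_square)
    also have "\<dots> \<le> (T x)\<^sup>2" using Tx by (simp add: abs_le_square_iff[symmetric])
    finally have "(t * L2_set ?y {..<n})\<^sup>2 \<le> \<bar>T x\<bar>\<^sup>2"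
      by (simp add: power_mult_distrib N)
    then have tl: "t * L2_set ?y {..<n} \<le> \<bar>T x\<bar>"
      using abs_ge_zero power2_le_imp_le by blast
    \<comment> \<open>A zero response would make the quotient 0 by convention; it is excluded
      because it forces \<open>T x = 0\<close>.\<close>
    have "L2_set ?y {..<n} \<noteq> 0"
    proof
      assume "L2_set ?y {..<n} = 0"
      then have "\<forall>i<n. L i x = 0" by (simp add: L2_set_eq_0_iff)
      then have "T x = 0" by (simp add: T_def)
      with Tx show False by simp
    qed
    then have "0 < L2_set ?y {..<n}"
      using L2_set_nonneg[of ?y "{..<n}"] by linarith
    then have "t \<le> \<bar>T x\<bar> / L2_set ?y {..<n}"
      using tl by (simp add: pos_le_divide_eq)
    then show ?thesis
      unfolding corr_test_iff T[symmetric] t_def[symmetric] using j by (intro bexI[of _ j]) auto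
  qed
  \<comment> \<open>The two Chebyshev events, with deviations squared to match the second moment
    bounds.\<close>
  let ?A = "{x \<in> space (gaussian K). (real n * a / 2)\<^sup>2 \<le> (T x - real n * a)\<^sup>2}"
  let ?B = "{x \<in> space (gaussian K). (3 * real n * v)\<^sup>2 \<le> (N x - real n * v)\<^sup>2}"
  have AB: "?A \<in> sets (gaussian K)" "?B \<in> sets (gaussian K)"
    using borel_measurable_integrable[OF M(1)] borel_measurable_integrable[OF M(3)] by measurable
  have "{(X, w) \<in> space G. \<not> corr_test n p \<epsilon> (X, Y X w)} =
      {z \<in> space ?V. \<not> corr_test n p \<epsilon> (fst z, (\<lambda>(X, w). Y X w) z)}"
    by (auto simp: G)
  then have "emeasure G {(X, w) \<in> space G. \<not> corr_test n p \<epsilon> (X, Y X w)} =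
      emeasure (gaussian K) (h -` {z \<in> space ?V. \<not> corr_test n p \<epsilon> (fst z, (\<lambda>(X, w). Y X w) z)} \<inter> space (gaussian K))"
    unfolding G using h meas by (simp add: emeasure_distr)
  also have "\<dots> \<le> emeasure (gaussian K) (?A \<union> ?B)"
  proof (rule emeasure_mono)
    show "h -` {z \<in> space ?V. \<not> corr_test n p \<epsilon> (fst z, (\<lambda>(X, w). Y X w) z)} \<inter> space (gaussian K) \<subseteq> ?A \<union> ?B"
    proof (rule subsetI, rule UnCI)
      fix x
      assume "x \<in> h -` {z \<in> space ?V. \<not> corr_test n p \<epsilon> (fst z, (\<lambda>(X, w). Y X w) z)} \<inter> space (gaussian K)"
        and "x \<notin> ?B"
      then have x: "x \<in> space (gaussian K)" "\<not> corr_test n p \<epsilon> (fst (h x), (\<lambda>(X, w). Y X w) (h x))"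
        "\<not> (3 * real n * v)\<^sup>2 \<le> (N x - real n * v)\<^sup>2"
        by auto
      then have "\<bar>N x - real n * v\<bar> < \<bar>3 * real n * v\<bar>"
        by (simp only: abs_le_square_iff[symmetric] not_le)
      moreover have "0 \<le> 3 * real n * v" using v1 by simp
      ultimately have "N x - real n * v < 3 * real n * v" by linarith
      then have "\<bar>real n * a / 2\<bar> \<le> \<bar>T x - real n * a\<bar>"
        using hit[of x] x(2) Yh[of x] by force
      then show "x \<in> ?A"
        using x(1) by (simp only: abs_le_square_iff mem_Collect_eq)
    qed
  qed (use AB in auto)
  also have "\<dots> \<le> emeasure (gaussian K) ?A + emeasure (gaussian K) ?B"
    using AB by (rule emeasure_subadditive)
  also have "\<dots> \<le> ennreal ((real n * (3 * v) + ((\<Sum>i<n. c (i, j)) - real n * a)\<^sup>2) / (real n * a / 2)\<^sup>2)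
      + ennreal (1 / (3 * real n))"
  proof (rule add_mono)
    have "prob ?A \<le> (\<integral>x. (T x - real n * a)\<^sup>2 \<partial>gaussian K) / (real n * a / 2)\<^sup>2"
      using M(1) a n by (intro integral_Markov_inequality_measure[where A="{}"]) auto
    also have "\<dots> \<le> (real n * (3 * v) + ((\<Sum>i<n. c (i, j)) - real n * a)\<^sup>2) / (real n * a / 2)\<^sup>2"
      using M(2) by (intro divide_right_mono) auto
    finally show "emeasure (gaussian K) ?A \<le> ennreal ((real n * (3 * v) + ((\<Sum>i<n. c (i, j)) - real n * a)\<^sup>2) / (real n * a / 2)\<^sup>2)"
      by (simp add: emeasure_eq_measure ennreal_leI)
    have "prob ?B \<le> (\<integral>x. (N x - real n * v)\<^sup>2 \<partial>gaussian K) / (3 * real n * v)\<^sup>2"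
      using M(3) v1 n by (intro integral_Markov_inequality_measure[where A="{}"]) auto
    also have "\<dots> \<le> real n * (3 * v\<^sup>2) / (3 * real n * v)\<^sup>2"
      using M(4) by (intro divide_right_mono) auto
    also have "\<dots> = 1 / (3 * real n)"
      using n v1 by (simp add: power2_eq_square)
    finally show "emeasure (gaussian K) ?B \<le> ennreal (1 / (3 * real n))"
      by (simp add: emeasure_eq_measure ennreal_leI)
  qed
  also have "\<dots> = ennreal ((real n * (3 * v) + ((\<Sum>i<n. c (i, j)) - real n * a)\<^sup>2) / (real n * a / 2)\<^sup>2 + 1 / (3 * real n))"
    using v1 by (intro ennreal_plus[symmetric]) auto
  finally show ?thesis .
qed

section \<open>Averaging over the labels\<close>

abbreviation labels :: "nat \<Rightarrow> real \<Rightarrow> (nat \<Rightarrow> bool) measure" where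
  "labels n \<phi> \<equiv> Pi\<^sub>M {..<n} (\<lambda>_. measure_pmf (bernoulli_pmf \<phi>))"

lemma prob_space_labels: "prob_space (labels n \<phi>)"
  by (intro prob_space_PiM) (rule prob_space_measure_pmf)

text \<open>Since \<open>a\<close> is the mean of \<open>f\<close> under the Bernoulli law, the sum
  over independent labels has no bias, and only variances at most \<open>B\<close> remain. In the
  application \<open>f\<close> gives the coefficient of the chosen column.\<close>

lemma labels_second_moment:
  fixes f :: "bool \<Rightarrow> real" and \<phi> B :: real
  assumes \<phi>: "0 \<le> \<phi>" "\<phi> \<le> 1" and n: "0 < n" and B: "(f True)\<^sup>2 \<le> B" "(f False)\<^sup>2 \<le> B"
  defines "a \<equiv> \<phi> * f True + (1 - \<phi>) * f False"
  shows "integrable (labels n \<phi>) (\<lambda>z. ((\<Sum>i<n. f (z i)) - real n * a)\<^sup>2)"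
    and "(\<integral>z. ((\<Sum>i<n. f (z i)) - real n * a)\<^sup>2 \<partial>labels n \<phi>) \<le> real n * B"
proof -
  interpret prob_space "labels n \<phi>" by (rule prob_space_labels)
  let ?b = "measure_pmf (bernoulli_pmf \<phi>)"
  have int: "integrable ?b g" for g :: "bool \<Rightarrow> real"
    by (rule integrable_measure_pmf_finite) simp
  have E: "integrable (labels n \<phi>) (\<lambda>z. g (z i)) \<and> expectation (\<lambda>z. g (z i)) = \<phi> * g True + (1 - \<phi>) * g False"
    if "i < n" for i and g :: "bool \<Rightarrow> real"
  proof -
    have d: "distr (labels n \<phi>) ?b (\<lambda>z. z i) = ?b"
      using that by (intro distr_PiM_component) (auto simp: prob_space_measure_pmf)
    have m: "(\<lambda>z. z i) \<in> labels n \<phi> \<rightarrow>\<^sub>M ?b"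
      using that by (intro measurable_component_singleton) auto
    show ?thesis
      using integrable_distr_eq[OF m, of g] integral_distr[OF m, of g] int[of g] \<phi> by (simp add: d mult.commute)
  qed
  have "indep_vars (\<lambda>_. ?b) (\<lambda>i z. z i) {..<n}"
    using n by (intro indep_vars_PiM_components) (auto simp: prob_space_measure_pmf lessThan_empty_iff)
  then have ind: "indep_vars (\<lambda>_. borel) (\<lambda>i z. f (z i)) {..<n}"
    by (rule indep_vars_compose2[where Y="\<lambda>_. f"]) auto
  have int2: "integrable (labels n \<phi>) (\<lambda>z. (f (z i))\<^sup>2)" if "i \<in> {..<n}" for i
    using E[of i "\<lambda>b. (f b)\<^sup>2"] that by simp
  have le: "expectation (\<lambda>z. (f (z i))\<^sup>2) \<le> B" if "i \<in> {..<n}" for i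
  proof -
    have "expectation (\<lambda>z. (f (z i))\<^sup>2) = \<phi> * (f True)\<^sup>2 + (1 - \<phi>) * (f False)\<^sup>2"
      using E[of i "\<lambda>b. (f b)\<^sup>2"] that by simp
    also have "\<dots> \<le> \<phi> * B + (1 - \<phi>) * B"
      using \<phi> B by (intro add_mono mult_left_mono) auto
    finally show ?thesis by (simp add: algebra_simps)
  qed
  show "integrable (labels n \<phi>) (\<lambda>z. ((\<Sum>i<n. f (z i)) - real n * a)\<^sup>2)"
    using second_moment_indep_sum(1)[OF _ ind int2 le] by simp
  show "(\<integral>z. ((\<Sum>i<n. f (z i)) - real n * a)\<^sup>2 \<partial>labels n \<phi>) \<le> real n * B"
    using second_moment_indep_sum(2)[OF _ ind int2 le, of "real n * a"] E[of _ f] by (simp add: a_def)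
qed

text \<open>In each row the label selects one signal, which brings the response into the form with
  frozen coefficients.\<close>

lemma mslr_response_eq:
  "mslr_response n p \<sigma> X w z b1 b2 =
    (\<lambda>i\<in>{..<n}. (\<Sum>l<p. X (i, l) * ((if z i then b1 l else b2 l) / \<sigma>)) + w i)"
  by (auto simp: mslr_response_def fun_eq_iff sum_divide_distrib)

lemma corr_miss_fixed_signals:
  fixes b1 b2 :: "nat \<Rightarrow> real" and n p j :: nat and r \<sigma> \<phi> \<epsilon> :: real
  defines "G \<equiv> gaussian ({..<n} \<times> {..<p}) \<Otimes>\<^sub>M gaussian {..<n}"
    and "v \<equiv> r\<^sup>2 / \<sigma>\<^sup>2 + 1" and "a \<equiv> (\<phi> * b1 j + (1 - \<phi>) * b2 j) / \<sigma>"
  assumes j: "j < p" and n: "0 < n" and \<sigma>: "0 < \<sigma>" and \<phi>: "0 \<le> \<phi>" "\<phi> \<le> 1"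
    and a: "a \<noteq> 0" and t: "0 \<le> corr_threshold p \<epsilon>"
    and norm: "L2_set b1 {..<p} = r" "L2_set b2 {..<p} = r"
    and le: "16 * v * (corr_threshold p \<epsilon>)\<^sup>2 \<le> real n * a\<^sup>2"
  shows "(\<integral>\<^sup>+z. emeasure G {(X, w) \<in> space G. \<not> corr_test n p \<epsilon> (X, mslr_response n p \<sigma> X w z b1 b2)} \<partial>labels n \<phi>)
    \<le> ennreal (16 * v / (real n * a\<^sup>2) + 1 / (3 * real n))"
proof -
  interpret prob_space "labels n \<phi>" by (rule prob_space_labels)
  let ?b = "\<lambda>s. if s then b1 else b2"
  define f where "f s = ?b s j / \<sigma>" for s
  have sq: "(\<Sum>l<p. (?b s l)\<^sup>2) = r\<^sup>2" for s
    using norm by (auto simp: L2_set_def sum_nonneg)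
  have f: "(f s)\<^sup>2 \<le> v" for s
  proof -
    \<comment> \<open>One squared coordinate is at most the squared norm, hence the squared
      coefficient is at most the SNR, which is below \<open>v\<close>.\<close>
    have "(?b s j)\<^sup>2 \<le> (\<Sum>l<p. (?b s l)\<^sup>2)"
      by (rule member_le_sum) (use j in auto)
    then show ?thesis
      using \<sigma> unfolding sq by (simp add: f_def v_def power_divide divide_right_mono add_increasing2)
  qed
  have v: "1 \<le> v" by (simp add: v_def)
  have af: "a = \<phi> * f True + (1 - \<phi>) * f False"
    by (simp add: a_def f_def add_divide_distrib)
  note F = labels_second_moment[where f=f, OF \<phi> n f f, folded af]
  let ?g = "\<lambda>z. (real n * (3 * v) + ((\<Sum>i<n. f (z i)) - real n * a)\<^sup>2) / (real n * a / 2)\<^sup>2 + 1 / (3 * real n)"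
  have "emeasure G {(X, w) \<in> space G. \<not> corr_test n p \<epsilon> (X, mslr_response n p \<sigma> X w z b1 b2)} \<le> ennreal (?g z)" for z
  proof -
    have "(\<Sum>l<p. (?b (z i) l / \<sigma>)\<^sup>2) + 1 = v" for i
      by (simp only: power_divide sum_divide_distrib[symmetric] sq v_def)
    then show ?thesis
      using corr_miss_fixed_coefficients[OF j n a t _ le, of "\<lambda>(i, l). ?b (z i) l / \<sigma>"]
      by (simp add: mslr_response_eq G_def f_def if_distrib[of "\<lambda>b. b _"] cong: if_cong)
  qed
  then have "(\<integral>\<^sup>+z. emeasure G {(X, w) \<in> space G. \<not> corr_test n p \<epsilon> (X, mslr_response n p \<sigma> X w z b1 b2)} \<partial>labels n \<phi>)
      \<le> (\<integral>\<^sup>+z. ennreal (?g z) \<partial>labels n \<phi>)"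
    by (rule nn_integral_mono)
  also have "\<dots> = ennreal (\<integral>z. ?g z \<partial>labels n \<phi>)"
    using F(1) v by (intro nn_integral_eq_integral) auto
  also have "(\<integral>z. ?g z \<partial>labels n \<phi>) =
      (real n * (3 * v) + (\<integral>z. ((\<Sum>i<n. f (z i)) - real n * a)\<^sup>2 \<partial>labels n \<phi>)) / (real n * a / 2)\<^sup>2 + 1 / (3 * real n)"
    using F(1) by (simp add: prob_space)
  also have "\<dots> \<le> (real n * (3 * v) + real n * v) / (real n * a / 2)\<^sup>2 + 1 / (3 * real n)"
    using F(2) by (intro add_right_mono divide_right_mono add_left_mono) auto
  also have "\<dots> = 16 * v / (real n * a\<^sup>2) + 1 / (3 * real n)"
    using n a by (simp add: power2_eq_square field_simps)
  finally show ?thesis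
    by (simp add: ennreal_leI)
qed

section \<open>The alternative law as an iterated integral\<close>

text \<open>Tonelli, moving the last factor outermost: design and noise are to be integrated first,
  with labels and signals held fixed.\<close>

lemma nn_integral_pair_rotate:
  assumes A: "sigma_finite_measure A" and B: "sigma_finite_measure B" and C: "sigma_finite_measure C"
    and f [measurable]: "f \<in> borel_measurable (A \<Otimes>\<^sub>M (B \<Otimes>\<^sub>M C))"
  shows "(\<integral>\<^sup>+x. f x \<partial>(A \<Otimes>\<^sub>M (B \<Otimes>\<^sub>M C))) = (\<integral>\<^sup>+c. \<integral>\<^sup>+(a, b). f (a, b, c) \<partial>(A \<Otimes>\<^sub>M B) \<partial>C)"
proof -
  interpret B: sigma_finite_measure B by fact
  interpret C: sigma_finite_measure C by fact
  interpret BC: pair_sigma_finite B C by (intro pair_sigma_finite.intro assms)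
  interpret AB: pair_sigma_finite A B by (intro pair_sigma_finite.intro assms)
  interpret ABC: pair_sigma_finite "A \<Otimes>\<^sub>M B" C
    by (intro pair_sigma_finite.intro AB.sigma_finite_measure_axioms C)
  have "(\<integral>\<^sup>+x. f x \<partial>(A \<Otimes>\<^sub>M (B \<Otimes>\<^sub>M C))) = (\<integral>\<^sup>+a. \<integral>\<^sup>+y. f (a, y) \<partial>(B \<Otimes>\<^sub>M C) \<partial>A)"
    by (rule sigma_finite_measure.nn_integral_fst[OF BC.sigma_finite_measure_axioms, symmetric]) simp
  also have "\<dots> = (\<integral>\<^sup>+a. \<integral>\<^sup>+b. \<integral>\<^sup>+c. f (a, b, c) \<partial>C \<partial>B \<partial>A)"
    by (intro nn_integral_cong C.nn_integral_fst[symmetric]) simp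
  also have "\<dots> = (\<integral>\<^sup>+x. \<integral>\<^sup>+c. f (fst x, snd x, c) \<partial>C \<partial>(A \<Otimes>\<^sub>M B))"
    by (subst B.nn_integral_fst[symmetric]) simp_all
  also have "\<dots> = (\<integral>\<^sup>+c. \<integral>\<^sup>+x. f (fst x, snd x, c) \<partial>(A \<Otimes>\<^sub>M B) \<partial>C)"
    by (rule ABC.Fubini'[symmetric]) simp
  finally show ?thesis by (simp add: split_def)
qed

lemma measurable_mslr [measurable]:
  "(\<lambda>(X, w, z, b1, b2). (X, mslr_response n p \<sigma> X w z b1 b2)) \<in>
    vec_borel ({..<n} \<times> {..<p}) \<Otimes>\<^sub>M vec_borel {..<n} \<Otimes>\<^sub>M labels n \<phi> \<Otimes>\<^sub>M (vec_borel {..<p} \<Otimes>\<^sub>M vec_borel {..<p})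
    \<rightarrow>\<^sub>M vec_borel ({..<n} \<times> {..<p}) \<Otimes>\<^sub>M vec_borel {..<n}"
  unfolding mslr_response_def split_def
  by (intro measurable_Pair measurable_restrict) measurable

lemma
  fixes n p :: nat and \<sigma> \<phi> \<epsilon> :: real
  assumes \<mu>: "prob_space \<mu>" and sets_\<mu>: "sets \<mu> = sets (vec_borel {..<p} \<Otimes>\<^sub>M vec_borel {..<p})"
  defines "P \<equiv> alt_law n p \<sigma> \<phi> \<mu>"
    and "G \<equiv> gaussian ({..<n} \<times> {..<p}) \<Otimes>\<^sub>M gaussian {..<n}"
  shows prob_space_alt_law: "prob_space P"
    and sets_alt_law: "sets P = sets (vec_borel ({..<n} \<times> {..<p}) \<Otimes>\<^sub>M vec_borel {..<n})"
    and emeasure_alt_law: "emeasure P {x \<in> space P. \<not> corr_test n p \<epsilon> x} =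
      (\<integral>\<^sup>+(b1, b2). \<integral>\<^sup>+z. emeasure G {(X, w) \<in> space G. \<not> corr_test n p \<epsilon> (X, mslr_response n p \<sigma> X w z b1 b2)}
        \<partial>labels n \<phi> \<partial>\<mu>)"
proof -
  let ?V = "vec_borel ({..<n} \<times> {..<p}) \<Otimes>\<^sub>M vec_borel {..<n}"
  let ?A = "gaussian ({..<n} \<times> {..<p})" and ?B = "gaussian {..<n}" and ?Z = "labels n \<phi>"
  interpret A: prob_space ?A by (rule prob_space_gaussian)
  interpret B: prob_space ?B by (rule prob_space_gaussian)
  interpret Z: prob_space ?Z by (rule prob_space_labels)
  interpret \<mu>: prob_space \<mu> by fact
  interpret AB: pair_prob_space ?A ?B ..
  interpret Z\<mu>: pair_prob_space ?Z \<mu> ..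
  interpret BZ\<mu>: pair_prob_space ?B "?Z \<Otimes>\<^sub>M \<mu>" ..
  interpret ABZ\<mu>: pair_prob_space ?A "?B \<Otimes>\<^sub>M (?Z \<Otimes>\<^sub>M \<mu>)" ..
  define F where "F = (\<lambda>(X, w, z, b1, b2). (X, mslr_response n p \<sigma> X w z b1 b2))"
  let ?\<Omega> = "?A \<Otimes>\<^sub>M (?B \<Otimes>\<^sub>M (?Z \<Otimes>\<^sub>M \<mu>))"
  have F [measurable]: "F \<in> ?\<Omega> \<rightarrow>\<^sub>M ?V"
    using measurable_mslr[of n p \<sigma> \<phi>] unfolding F_def
    by (subst measurable_cong_sets[OF _ refl])
       (auto intro!: sets_pair_measure_cong simp: sets_gaussian sets_\<mu>)
  have P: "P = distr ?\<Omega> ?V F" by (simp add: P_def alt_law_def F_def)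
  show "prob_space P"
    unfolding P using F by (rule ABZ\<mu>.prob_space_distr)
  show "sets P = sets ?V" by (simp add: P)
  define U where "U = {x \<in> space ?V. \<not> corr_test n p \<epsilon> x}"
  have U [measurable]: "U \<in> sets ?V"
    unfolding U_def by measurable
  define f :: "_ \<Rightarrow> ennreal" where "f x = indicator U (F x)" for x
  have f [measurable]: "f \<in> borel_measurable ?\<Omega>"
    unfolding f_def[abs_def] by measurable
  \<comment> \<open>For \<open>c = (z, b)\<close> this is the conditional miss probability given
    labels and signals.\<close>
  define g where "g c = (\<integral>\<^sup>+x. f (fst x, snd x, c) \<partial>G)" for c
  have g: "g \<in> borel_measurable (?Z \<Otimes>\<^sub>M \<mu>)"
  proof -
    have "(\<lambda>(c, x). f (fst x, snd x, c)) \<in> borel_measurable ((?Z \<Otimes>\<^sub>M \<mu>) \<Otimes>\<^sub>M G)"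
      unfolding G_def by measurable
    then show ?thesis
      unfolding G_def g_def[abs_def]
      by (rule sigma_finite_measure.borel_measurable_nn_integral[OF AB.sigma_finite_measure_axioms])
  qed
  have "emeasure P {x \<in> space P. \<not> corr_test n p \<epsilon> x} = (\<integral>\<^sup>+x. indicator U x \<partial>P)"
    by (simp add: P U_def[symmetric])
  also have "\<dots> = (\<integral>\<^sup>+x. f x \<partial>?\<Omega>)"
    unfolding P f_def by (rule nn_integral_distr) measurable
  also have "\<dots> = (\<integral>\<^sup>+c. \<integral>\<^sup>+(X, w). f (X, w, c) \<partial>G \<partial>(?Z \<Otimes>\<^sub>M \<mu>))"
    unfolding G_def by (rule nn_integral_pair_rotate[OF _ _ _ f]) unfold_locales
  also have "\<dots> = (\<integral>\<^sup>+c. g c \<partial>(?Z \<Otimes>\<^sub>M \<mu>))"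
    by (simp add: g_def split_def)
  also have "\<dots> = (\<integral>\<^sup>+b. \<integral>\<^sup>+z. g (z, b) \<partial>?Z \<partial>\<mu>)"
    using g by (rule Z\<mu>.nn_integral_snd[symmetric])
  also have "\<dots> = (\<integral>\<^sup>+(b1, b2). \<integral>\<^sup>+z. emeasure G
      {(X, w) \<in> space G. \<not> corr_test n p \<epsilon> (X, mslr_response n p \<sigma> X w z b1 b2)} \<partial>?Z \<partial>\<mu>)"
  proof (rule nn_integral_cong)
    fix b assume b: "b \<in> space \<mu>"
    have "g (z, b) = emeasure G
        {(X, w) \<in> space G. \<not> corr_test n p \<epsilon> (X, mslr_response n p \<sigma> X w z (fst b) (snd b))}" (is "_ = emeasure G ?E")
      if z: "z \<in> space ?Z" for z
    proof -
      let ?h = "\<lambda>x. F (fst x, snd x, z, b)"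
      have hm: "?h \<in> G \<rightarrow>\<^sub>M ?V"
        unfolding G_def using b z by measurable
      have E: "?E = ?h -` U \<inter> space G"
        using measurable_space[OF hm] by (auto simp: F_def U_def split_def)
      have "g (z, b) = (\<integral>\<^sup>+x. indicator ?E x \<partial>G)"
        unfolding g_def f_def E by (intro nn_integral_cong) (auto simp: indicator_def)
      also have "\<dots> = emeasure G ?E"
        using measurable_sets[OF hm U] by (simp add: E)
      finally show ?thesis .
    qed
    then show "(\<integral>\<^sup>+z. g (z, b) \<partial>?Z) = (case b of (b1, b2) \<Rightarrow> \<integral>\<^sup>+z. emeasure G
        {(X, w) \<in> space G. \<not> corr_test n p \<epsilon> (X, mslr_response n p \<sigma> X w z b1 b2)} \<partial>?Z)"
      by (cases b) (simp cong: nn_integral_cong)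
  qed
  finally show "emeasure P {x \<in> space P. \<not> corr_test n p \<epsilon> x} =
      (\<integral>\<^sup>+(b1, b2). \<integral>\<^sup>+z. emeasure G {(X, w) \<in> space G. \<not> corr_test n p \<epsilon> (X, mslr_response n p \<sigma> X w z b1 b2)}
        \<partial>?Z \<partial>\<mu>)" .
qed

section \<open>The minimising column and the sample size condition\<close>

lemma corr_threshold_sq:
  assumes "1 \<le> p" "0 < \<epsilon>"
  shows "0 < corr_threshold p \<epsilon>" "(corr_threshold p \<epsilon>)\<^sup>2 = 2 * (1 + \<epsilon> / 2) * ln (2 * real p)"
  using assms by (auto simp: corr_threshold_def)

text \<open>If every averaged entry vanished, then \<open>\<phi> * b1 = - (1 - \<phi>) * b2\<close>
  on all coordinates. Equal nonzero norms force \<open>\<phi> = 1 - \<phi>\<close>, so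
  \<open>\<phi> = 1/2\<close> and \<open>b1 = - b2\<close>, the excluded regime. Hence the minimum
  is over a nonempty finite set.\<close>

lemma mean_sq_min_attained:
  assumes r: "r \<noteq> 0" and norm: "L2_set b1 {..<p} = r" "L2_set b2 {..<p} = r"
    and \<phi>: "0 < \<phi>" "\<phi> < 1" and ns: "\<not> symmetric_balanced p \<phi> b1 b2"
  obtains j where "j < p" "\<phi> * b1 j + (1 - \<phi>) * b2 j \<noteq> 0"
    "mean_sq_min p \<phi> b1 b2 = (\<phi> * b1 j + (1 - \<phi>) * b2 j)\<^sup>2"
proof -
  define m where "m j = \<phi> * b1 j + (1 - \<phi>) * b2 j" for j
  define A where "A = {(m j)\<^sup>2 | j. j \<in> supp p b1 \<union> supp p b2 \<and> m j \<noteq> 0}"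
  have "A \<subseteq> (\<lambda>j. (m j)\<^sup>2) ` {..<p}" by (auto simp: A_def supp_def)
  then have "finite A" by (rule finite_subset) simp
  moreover have "A \<noteq> {}"
  proof
    assume "A = {}"
    then have "m j = 0" if "j \<in> supp p b1 \<union> supp p b2" for j
      using that unfolding A_def by blast
    moreover have "m j = 0" if "j < p" "j \<notin> supp p b1 \<union> supp p b2" for j
      using that by (simp add: supp_def m_def)
    ultimately have m0: "\<phi> * b1 j = - ((1 - \<phi>) * b2 j)" if "j < p" for j
      using that unfolding m_def by (cases "j \<in> supp p b1 \<union> supp p b2") (auto simp: eq_neg_iff_add_eq_0)
    have "L2_set (\<lambda>j. \<phi> * b1 j) {..<p} = \<phi> * r"
      using \<phi> norm L2_set_right_distrib[of \<phi> b1 "{..<p}"] by simp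
    moreover have "L2_set (\<lambda>j. - ((1 - \<phi>) * b2 j)) {..<p} = (1 - \<phi>) * r"
      using \<phi> norm L2_set_right_distrib[of "1 - \<phi>" b2 "{..<p}"] by (simp add: L2_set_def)
    moreover have "L2_set (\<lambda>j. \<phi> * b1 j) {..<p} = L2_set (\<lambda>j. - ((1 - \<phi>) * b2 j)) {..<p}"
      by (rule L2_set_cong) (use m0 in auto)
    ultimately have half: "\<phi> = 1 / 2" using r by (simp add: algebra_simps)
    have "b1 j = - b2 j" if "j < p" for j
      using m0[OF that] unfolding half by simp
    with half show False using ns by (simp add: symmetric_balanced_def)
  qed
  ultimately have "Min A \<in> A" by (rule Min_in)
  then obtain j where "Min A = (m j)\<^sup>2" "j < p" "m j \<noteq> 0"
    by (auto simp: A_def supp_def)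
  then show thesis
    using that[of j] unfolding A_def m_def mean_sq_min_def by blast
qed

text \<open>For almost every pair of signals, the sample size condition at the minimising column
  makes both the threshold comparison and the Chebyshev bound hold uniformly; integrating over the
  prior preserves the bound.\<close>

lemma corr_miss_alt:
  assumes prior: "signal_prior p k D r \<mu>" and k: "1 \<le> k" and \<sigma>: "0 < \<sigma>" and \<phi>: "0 < \<phi>" "\<phi> < 1"
    and \<epsilon>: "0 < \<epsilon>" and p: "1 \<le> p" and n: "0 < n" and D: "0 < beta_min D"
    and ns: "AE (b1, b2) in \<mu>. \<not> symmetric_balanced p \<phi> b1 b2"
    and size: "AE (b1, b2) in \<mu>. real n \<ge> 32 * (1 + \<epsilon>)
        / Min {\<phi>\<^sup>2 * (beta_min D)\<^sup>2, (1 - \<phi>)\<^sup>2 * (beta_min D)\<^sup>2, mean_sq_min p \<phi> b1 b2}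
        * (r\<^sup>2 * (SNR r \<sigma> + 1) / SNR r \<sigma>) * ln (2 * real p)"
  shows "emeasure (alt_law n p \<sigma> \<phi> \<mu>) {x \<in> space (alt_law n p \<sigma> \<phi> \<mu>). \<not> corr_test n p \<epsilon> x}
    \<le> ennreal (1 / (2 * ln (2 * real p)) + 1 / (3 * real n))"
proof -
  from prior interpret \<mu>: prob_space \<mu> by (simp add: signal_prior_def)
  have sets: "sets \<mu> = sets (vec_borel {..<p} \<Otimes>\<^sub>M vec_borel {..<p})"
    using prior by (simp add: signal_prior_def)
  let ?S = "sparse_signals p k D r" and ?l = "ln (2 * real p)"
  let ?G = "gaussian ({..<n} \<times> {..<p}) \<Otimes>\<^sub>M gaussian {..<n}"
  have l: "0 < ?l" using p by simp
  have fs: "fst \<in> \<mu> \<rightarrow>\<^sub>M vec_borel {..<p}" "snd \<in> \<mu> \<rightarrow>\<^sub>M vec_borel {..<p}"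
    unfolding measurable_cong_sets[OF sets refl] by measurable
  have "AE b in \<mu>. fst b \<in> ?S" "AE b in \<mu>. snd b \<in> ?S"
    using prior fs[THEN AE_distrD, of "\<lambda>b. b \<in> ?S"] by (auto simp: signal_prior_def uniform_on_def)
  then have "AE (b1, b2) in \<mu>. (\<integral>\<^sup>+z. emeasure ?G {(X, w) \<in> space ?G. \<not> corr_test n p \<epsilon> (X, mslr_response n p \<sigma> X w z b1 b2)} \<partial>labels n \<phi>)
      \<le> ennreal (1 / (2 * ?l) + 1 / (3 * real n))"
    using ns size
  proof eventually_elim
    case (elim b)
    obtain b1 b2 where b: "b = (b1, b2)" by (cases b)
    have norm: "L2_set b1 {..<p} = r" "L2_set b2 {..<p} = r" and "card (supp p b1) = k"
      using elim(1,2) by (auto simp: b sparse_signals_def)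
    \<comment> \<open>At least one nonzero entry makes the common norm nonzero, so that SNR can be
      cancelled.\<close>
    then have "supp p b1 \<noteq> {}" using k by auto
    then obtain i where "i < p" "b1 i \<noteq> 0" by (auto simp: supp_def)
    then have "L2_set b1 {..<p} \<noteq> 0" by (auto simp: L2_set_eq_0_iff)
    then have r: "r \<noteq> 0" using norm by simp
    obtain j where j: "j < p" and m0: "\<phi> * b1 j + (1 - \<phi>) * b2 j \<noteq> 0"
      and msm: "mean_sq_min p \<phi> b1 b2 = (\<phi> * b1 j + (1 - \<phi>) * b2 j)\<^sup>2"
      using mean_sq_min_attained[OF r norm \<phi>] elim(3) by (auto simp: b)
    define m where "m = \<phi> * b1 j + (1 - \<phi>) * b2 j"
    define v where "v = r\<^sup>2 / \<sigma>\<^sup>2 + 1"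
    define q where "q = Min {\<phi>\<^sup>2 * (beta_min D)\<^sup>2, (1 - \<phi>)\<^sup>2 * (beta_min D)\<^sup>2, m\<^sup>2}"
    have m: "m \<noteq> 0" using m0 by (simp add: m_def)
    \<comment> \<open>Positivity rules out division by zero in the sample size condition; it comes
      from \<open>beta_min D > 0\<close>, \<open>0 < \<phi> < 1\<close> and
      \<open>m \<noteq> 0\<close>.\<close>
    have q: "0 < q" "q \<le> m\<^sup>2"
      using \<phi> D m by (auto simp: q_def)
    have v: "1 \<le> v" by (simp add: v_def)
    have snr: "r\<^sup>2 * (SNR r \<sigma> + 1) / SNR r \<sigma> = \<sigma>\<^sup>2 * v"
      using r \<sigma> by (simp add: SNR_def v_def)
    have "32 * (1 + \<epsilon>) * (v * ?l) * \<sigma>\<^sup>2 / q \<le> real n"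
      using elim(4) unfolding b split_conv msm m_def[symmetric] q_def[symmetric] snr
      by (simp add: mult_ac)
    then have "32 * (1 + \<epsilon>) * (v * ?l) * \<sigma>\<^sup>2 \<le> real n * q"
      using q by (simp add: pos_divide_le_eq)
    also have "\<dots> \<le> real n * m\<^sup>2"
      using q by (intro mult_left_mono) auto
    finally have na: "32 * (1 + \<epsilon>) * (v * ?l) \<le> real n * (m / \<sigma>)\<^sup>2"
      using \<sigma> by (simp add: power_divide pos_le_divide_eq)
    have vl: "0 < v * ?l" using v l by simp
    \<comment> \<open>The threshold contributes a factor 2, whence 32; passing from
      \<open>\<epsilon> / 2\<close> to \<open>\<epsilon>\<close> is slack.\<close>
    have "16 * v * (corr_threshold p \<epsilon>)\<^sup>2 = 32 * (1 + \<epsilon> / 2) * (v * ?l)"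
      using corr_threshold_sq[OF p \<epsilon>] by simp
    also have "\<dots> \<le> 32 * (1 + \<epsilon>) * (v * ?l)"
      using vl \<epsilon> by (intro mult_right_mono) auto
    also note na
    finally have le: "16 * v * (corr_threshold p \<epsilon>)\<^sup>2 \<le> real n * (m / \<sigma>)\<^sup>2" .
    \<comment> \<open>The miss bound needs only \<open>32 * v * ln (2 * p)\<close>, which reduces it
      to \<open>1 / (2 * ln (2 * p))\<close>.\<close>
    have "32 * (v * ?l) \<le> 32 * (1 + \<epsilon>) * (v * ?l)"
      using vl \<epsilon> by (intro mult_right_mono) auto
    also note na
    finally have "16 * v / (real n * (m / \<sigma>)\<^sup>2) \<le> 16 * v / (32 * (v * ?l))"
      using vl v n m \<sigma> by (intro divide_left_mono) auto
    also have "\<dots> = 1 / (2 * ?l)"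
      using v by simp
    finally have "16 * v / (real n * (m / \<sigma>)\<^sup>2) \<le> 1 / (2 * ?l)" .
    then have "ennreal (16 * v / (real n * (m / \<sigma>)\<^sup>2) + 1 / (3 * real n)) \<le> ennreal (1 / (2 * ?l) + 1 / (3 * real n))"
      by (intro ennreal_leI) simp
    moreover have "(\<integral>\<^sup>+z. emeasure ?G {(X, w) \<in> space ?G. \<not> corr_test n p \<epsilon> (X, mslr_response n p \<sigma> X w z b1 b2)} \<partial>labels n \<phi>)
        \<le> ennreal (16 * v / (real n * (m / \<sigma>)\<^sup>2) + 1 / (3 * real n))"
      unfolding m_def v_def
      using corr_miss_fixed_signals[OF j n \<sigma> _ _ _ _ norm] le \<phi> m \<sigma> corr_threshold_sq(1)[OF p \<epsilon>]
      by (simp add: m_def v_def)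
    ultimately show ?case
      unfolding b split_conv by (rule order_trans[rotated])
  qed
  then have "emeasure (alt_law n p \<sigma> \<phi> \<mu>) {x \<in> space (alt_law n p \<sigma> \<phi> \<mu>). \<not> corr_test n p \<epsilon> x}
      \<le> (\<integral>\<^sup>+b. ennreal (1 / (2 * ?l) + 1 / (3 * real n)) \<partial>\<mu>)"
    unfolding emeasure_alt_law[OF \<mu>.prob_space_axioms sets]
    by (intro nn_integral_mono_AE) (auto elim: eventually_mono)
  also have "\<dots> = ennreal (1 / (2 * ?l) + 1 / (3 * real n))"
    by (simp add: \<mu>.emeasure_space_1)
  finally show ?thesis .
qed

subsection \<open>Strong detection\<close>

text \<open>Squeezes the success probability between 1 minus the error bound and 1. The error bound
  is required only eventually, because early dimensions may be too small for it.\<close>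

lemma prob_tendsto_1I:
  fixes M :: "nat \<Rightarrow> 'a measure"
  assumes M: "\<And>m. prob_space (M m)"
    and meas: "\<And>m. {x \<in> space (M m). \<not> T m x} \<in> sets (M m)"
    and le: "eventually (\<lambda>m. emeasure (M m) {x \<in> space (M m). \<not> T m x} \<le> ennreal (\<delta> m)) sequentially"
    and nonneg: "eventually (\<lambda>m. 0 \<le> \<delta> m) sequentially" and \<delta>: "\<delta> \<longlonglongrightarrow> 0"
  shows "(\<lambda>m. measure (M m) {x \<in> space (M m). T m x}) \<longlonglongrightarrow> 1"
proof (rule tendsto_sandwich)
  show "eventually (\<lambda>m. 1 - \<delta> m \<le> measure (M m) {x \<in> space (M m). T m x}) sequentially"
    using le nonneg
  proof eventually_elim
    case (elim m)
    interpret prob_space "M m" by (rule M)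
    have "{x \<in> space (M m). T m x} = space (M m) - {x \<in> space (M m). \<not> T m x}" by auto
    then have "measure (M m) {x \<in> space (M m). T m x} = 1 - measure (M m) {x \<in> space (M m). \<not> T m x}"
      using prob_compl[OF meas] by simp
    then show ?case
      using elim by (simp add: emeasure_eq_measure)
  qed
  show "eventually (\<lambda>m. measure (M m) {x \<in> space (M m). T m x} \<le> 1) sequentially"
    using M by (simp add: prob_space.prob_le_1)
  show "(\<lambda>m. 1 - \<delta> m) \<longlonglongrightarrow> 1"
    using tendsto_diff[OF tendsto_const \<delta>, of 1] by simp
qed simp

theorem theorem2p5:
  fixes p n k :: "nat \<Rightarrow> nat"
    and D :: "nat \<Rightarrow> real set"
    and r \<sigma> \<phi> :: "nat \<Rightarrow> real"
    and \<mu> :: "nat \<Rightarrow> ((nat \<Rightarrow> real) \<times> (nat \<Rightarrow> real)) measure"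
    and \<epsilon> :: real
  assumes "filterlim p at_top sequentially"
    and "filterlim n at_top sequentially"
    and "(\<lambda>m. real (k m)) \<in> o(\<lambda>m. real (p m))"
    and "(\<lambda>m. real (n m)) \<in> \<omega>(\<lambda>m. real (k m))"
    and "\<And>m. k m \<ge> 1"
    and "\<And>m. \<sigma> m > 0"
    and "\<And>m. 0 < \<phi> m \<and> \<phi> m < 1"
    and "0 < \<epsilon>" and "\<epsilon> < 1"
    and "\<And>m. beta_min (D m) > 0"
    and "\<And>m. signal_prior (p m) (k m) (D m) (r m) (\<mu> m)"
    and "\<And>m. AE (b1, b2) in \<mu> m. \<not> symmetric_balanced (p m) (\<phi> m) b1 b2"
    and "\<And>m. AE (b1, b2) in \<mu> m.
           real (n m) \<ge>
             32 * (1 + \<epsilon>)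
             / Min {(\<phi> m)\<^sup>2 * (beta_min (D m))\<^sup>2,
                    (1 - \<phi> m)\<^sup>2 * (beta_min (D m))\<^sup>2,
                    mean_sq_min (p m) (\<phi> m) b1 b2}
             * ((r m)\<^sup>2 * (SNR (r m) (\<sigma> m) + 1) / SNR (r m) (\<sigma> m))
             * ln (2 * real (p m))"
  shows "strong_detection
           (\<lambda>m. null_law (n m) (p m) (r m) (\<sigma> m))
           (\<lambda>m. alt_law (n m) (p m) (\<sigma> m) (\<phi> m) (\<mu> m))
           (\<lambda>m. corr_test (n m) (p m) \<epsilon>)"
proof -
  let ?Q = "\<lambda>m. null_law (n m) (p m) (r m) (\<sigma> m)" and ?P = "\<lambda>m. alt_law (n m) (p m) (\<sigma> m) (\<phi> m) (\<mu> m)"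
  let ?T = "\<lambda>m. corr_test (n m) (p m) \<epsilon>"
  have p1: "eventually (\<lambda>m. 1 \<le> p m) sequentially" and "eventually (\<lambda>m. 1 \<le> n m) sequentially"
    using assms(1,2) unfolding filterlim_at_top by blast+
  then have n1: "eventually (\<lambda>m. 0 < n m) sequentially"
    by (simp add: Suc_le_eq)
  have pr: "filterlim (\<lambda>m. real (p m)) at_top sequentially" and nr: "filterlim (\<lambda>m. real (n m)) at_top sequentially"
    using assms(1,2) by (auto intro: filterlim_compose[OF filterlim_real_sequentially])
  have prior: "prob_space (\<mu> m)" "sets (\<mu> m) = sets (vec_borel {..<p m} \<Otimes>\<^sub>M vec_borel {..<p m})" for m
    using assms(11)[of m] by (auto simp: signal_prior_def)
  have "(\<lambda>m. measure (?Q m) {x \<in> space (?Q m). \<not> ?T m x}) \<longlonglongrightarrow> 1"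
  proof (rule prob_tendsto_1I[where \<delta>="\<lambda>m. (2 * real (p m)) powr (- \<epsilon> / 2)"])
    \<comment> \<open>Success under the null is the negated test, so its failure, a false positive,
      appears as a double negation.\<close>
    show "{x \<in> space (?Q m). \<not> \<not> ?T m x} \<in> sets (?Q m)" for m
      using measurable_corr_test[of "n m" "p m" \<epsilon>]
      by (intro predE) (simp add: measurable_cong_sets[OF sets_null_law refl])
    show "eventually (\<lambda>m. emeasure (?Q m) {x \<in> space (?Q m). \<not> \<not> ?T m x}
        \<le> ennreal ((2 * real (p m)) powr (- \<epsilon> / 2))) sequentially"
      using p1
    proof eventually_elim
      case (elim m)
      let ?t = "corr_threshold (p m) \<epsilon>"
      \<comment> \<open>Half the squared threshold is
        \<open>(1 + \<epsilon> / 2) * ln (2 * p)\<close>; the union bound factor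
        \<open>2 * p\<close> cancels one full power and leaves exponent
        \<open>- \<epsilon> / 2\<close>.\<close>
      have "exp (- ?t\<^sup>2 / 2) = (2 * real (p m)) powr (- 1 + - \<epsilon> / 2)"
        using elim corr_threshold_sq(2)[OF elim assms(8)] by (simp add: powr_def field_simps)
      also have "\<dots> = (2 * real (p m)) powr (- \<epsilon> / 2) / (2 * real (p m))"
        using elim unfolding powr_add by (simp add: powr_minus_divide)
      finally have "2 * real (p m) * exp (- ?t\<^sup>2 / 2) = (2 * real (p m)) powr (- \<epsilon> / 2)"
        using elim by simp
      then show ?case
        using null_false_positive[OF corr_threshold_sq(1)[OF elim assms(8)], of "n m" "r m" "\<sigma> m"] by simp
    qed
    show "(\<lambda>m. (2 * real (p m)) powr (- \<epsilon> / 2)) \<longlonglongrightarrow> 0"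
      using assms(8)
      by (intro tendsto_neg_powr filterlim_tendsto_pos_mult_at_top[OF tendsto_const _ pr]) auto
  qed (auto intro: prob_space_null_law)
  moreover have "(\<lambda>m. measure (?P m) {x \<in> space (?P m). ?T m x}) \<longlonglongrightarrow> 1"
  proof (rule prob_tendsto_1I[where \<delta>="\<lambda>m. 1 / (2 * ln (2 * real (p m))) + 1 / (3 * real (n m))"])
    show "prob_space (?P m)" for m
      using prior by (rule prob_space_alt_law)
    show "{x \<in> space (?P m). \<not> ?T m x} \<in> sets (?P m)" for m
      using measurable_corr_test[of "n m" "p m" \<epsilon>]
      by (intro predE pred_intros_logic) (simp add: measurable_cong_sets[OF sets_alt_law[OF prior] refl])
    show "eventually (\<lambda>m. emeasure (?P m) {x \<in> space (?P m). \<not> ?T m x}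
        \<le> ennreal (1 / (2 * ln (2 * real (p m))) + 1 / (3 * real (n m)))) sequentially"
      using p1 n1
    proof eventually_elim
      case (elim m)
      show ?case
        using assms(7)[of m] elim by (intro corr_miss_alt[OF assms(11,5,6) _ _ assms(8) _ _ assms(10,12,13)]) auto
    qed
    show "eventually (\<lambda>m. 0 \<le> 1 / (2 * ln (2 * real (p m))) + 1 / (3 * real (n m))) sequentially"
      using p1 by eventually_elim simp
    have "filterlim (\<lambda>m. 2 * ln (2 * real (p m))) at_top sequentially"
      by (intro filterlim_tendsto_pos_mult_at_top[OF tendsto_const] filterlim_compose[OF ln_at_top] pr) auto
    moreover have "filterlim (\<lambda>m. 3 * real (n m)) at_top sequentially"
      by (intro filterlim_tendsto_pos_mult_at_top[OF tendsto_const] nr) auto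
    ultimately have "(\<lambda>m. 1 / (2 * ln (2 * real (p m))) + 1 / (3 * real (n m))) \<longlonglongrightarrow> 0 + 0"
      by (intro tendsto_add tendsto_divide_0[OF tendsto_const] filterlim_at_top_imp_at_infinity)
    then show "(\<lambda>m. 1 / (2 * ln (2 * real (p m))) + 1 / (3 * real (n m))) \<longlonglongrightarrow> 0"
      by simp
  qed
  ultimately show ?thesis
    by (simp add: strong_detection_def)
qed

end
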